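(* Let $\mathcal Z$ be a finite nonempty zero-set. For every $\alpha,\beta\ge0$ the large deviation rate $I(\alpha,\beta,\mathcal Z)$ exists. Moreover there is a finite set $\mathcal A_0$ of finite spanning sets, depending only on $\mathcal Z$ (not on $\alpha,\beta$), such that $$I(\alpha,\beta,\mathcal Z)=\inf\{\rho(\alpha,\beta,A):A\in\mathcal A\}=\min\{\rho(\alpha,\beta,A):A\in\mathcal A_0\},$$ where $\mathcal A$ is the set of all finite spanning sets. As a function of $(\alpha,\beta)$, $I(\cdot,\cdot,\mathcal Z)$ is continuous, piecewise linear, nonincreasing in each argument, concave on $\{\alpha+\beta\le1\}$, and $I(0,0,\mathcal Z)=\gamma(\mathcal Z)>I(\alpha,\beta,\mathcal Z)$ whenever $(\alpha,\beta)\ne(0,0)$. Furthermore, the support of $I(\cdot,\cdot,\mathcal Z)$ in $[0,1]^2$ (the closure of the set where $I>0$) is $$\bigcap_{(u,v)\in\partial_o\mathcal Z}\{(\alpha,\beta)\in[0,1]^2:[u(1-\alpha)-\beta]\vee[v(1-\beta)-\alpha]\ge0\},$$ and if $(\alpha,\beta)\in[0,1]^2$ lies outside this support then $P_p(\mathrm{Span})\to1$ as $p\to0$.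
   Context: Let $\mathbb Z_+=\{0,1,2,\dots\}$, $R_{a,b}=([0,a-1]\times[0,b-1])\cap\mathbb Z_+^2$. A (discrete) zero-set is a set $\mathcal Z\subseteq\mathbb Z_+^2$ that is a union of rectangles $R_{a,b}$. For $A\subseteq\mathbb Z_+^2$, $x\in\mathbb Z_+^2$, $\mathrm{row}(x,A)$ (resp. $\mathrm{col}(x,A)$) is the number of points of $A$ on the horizontal (resp. vertical) line through $x$; the neighborhood growth transformation is $\mathcal T(A)=A\cup\{x\notin A:(\mathrm{row}(x,A),\mathrm{col}(x,A))\notin\mathcal Z\}$; $A$ spans if $\bigcup_t\mathcal T^t(A)=\mathbb Z_+^2$; $\gamma(\mathcal Z)$ is the minimum size of a finite spanning set. Large deviation setting: fix $\alpha,\beta\ge0$; as $p\to0$ let integers $N,M\to\infty$ with $\log N\sim-\alpha\log p$, $\log M\sim-\beta\log p$; the initial set $\omega_0$ contains each point of $R_{N,M}$ independently with probability $p$ (and no other points); $\mathrm{Span}$ is the event that $\omega_0$ spans; $I(\alpha,\beta,\mathcal Z)=\lim_{p\to0}\log P_p(\mathrm{Span})/\log p$ when the limit exists. For finite $A$, $\pi_x(A),\pi_y(A)$ are its projections onto the axes and $\rho(\alpha,\beta,A)=\max_{B\subseteq A}(|B|-\alpha|\pi_x(B)|-\beta|\pi_y(B)|)$. The outer boundary of a Young diagram $Y$ is $\partial_oY=\{(u,v)\in\mathbb Z_+^2\setminus Y:(u-1,v)\in Y\text{ or }(u,v-1)\in Y\}$; $a\vee b=\max(a,b)$. *)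

theory Defs
  imports "HOL-Analysis.Analysis"
begin

type_synonym pt = "nat \<times> nat"

definition rect :: "nat \<Rightarrow> nat \<Rightarrow> pt set" where
  "rect a b = {x. fst x < a \<and> snd x < b}"

definition zero_set :: "pt set \<Rightarrow> bool" where
  "zero_set Z \<longleftrightarrow> (\<exists>S :: (nat \<times> nat) set. Z = (\<Union>(a,b)\<in>S. rect a b))"

definition row_pts :: "pt \<Rightarrow> pt set \<Rightarrow> pt set" where
  "row_pts x A = {y \<in> A. snd y = snd x}"
definition col_pts :: "pt \<Rightarrow> pt set \<Rightarrow> pt set" where
  "col_pts x A = {y \<in> A. fst y = fst x}"

text \<open>Neighborhood growth transformation. The pair (row(x,A), col(x,A)) lies in Z
  only if both counts are finite (Z consists of pairs of finite numbers).\<close>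
definition NG :: "pt set \<Rightarrow> pt set \<Rightarrow> pt set" where
  "NG Z A = A \<union> {x. x \<notin> A \<and>
      \<not> (finite (row_pts x A) \<and> finite (col_pts x A) \<and>
          (card (row_pts x A), card (col_pts x A)) \<in> Z)}"

definition spans :: "pt set \<Rightarrow> pt set \<Rightarrow> bool" where
  "spans Z A \<longleftrightarrow> (\<Union>t. (NG Z ^^ t) A) = UNIV"

definition gamma :: "pt set \<Rightarrow> nat" where
  "gamma Z = (LEAST n. \<exists>A. finite A \<and> spans Z A \<and> card A = n)"

definition rho :: "real \<Rightarrow> real \<Rightarrow> pt set \<Rightarrow> real" where
  "rho \<alpha> \<beta> A = Max ((\<lambda>B. real (card B) - \<alpha> * real (card (fst ` B))
                                         - \<beta> * real (card (snd ` B))) ` Pow A)"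

definition outer_boundary :: "pt set \<Rightarrow> pt set" where
  "outer_boundary Y = {(u,v). (u,v) \<notin> Y \<and>
      ((u \<ge> 1 \<and> (u - 1, v) \<in> Y) \<or> (v \<ge> 1 \<and> (u, v - 1) \<in> Y))}"

text \<open>P_p(Span): each point of R_{N,M} present independently with probability p.\<close>
definition span_prob :: "pt set \<Rightarrow> nat \<Rightarrow> nat \<Rightarrow> real \<Rightarrow> real" where
  "span_prob Z N M p =
     (\<Sum>S\<in>{S. S \<subseteq> rect N M \<and> spans Z S}. p ^ card S * (1 - p) ^ (N * M - card S))"

text \<open>Admissible scalings: as p -> 0+, N, M -> infinity with
  log N ~ -alpha log p and log M ~ -beta log p (read as ratios converging).\<close>
definition admissible :: "real \<Rightarrow> real \<Rightarrow> (real \<Rightarrow> nat) \<Rightarrow> (real \<Rightarrow> nat) \<Rightarrow> bool" where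
  "admissible \<alpha> \<beta> N M \<longleftrightarrow>
     filterlim N at_top (at_right 0) \<and> filterlim M at_top (at_right 0) \<and>
     ((\<lambda>p. ln (real (N p)) / (- ln p)) \<longlongrightarrow> \<alpha>) (at_right 0) \<and>
     ((\<lambda>p. ln (real (M p)) / (- ln p)) \<longlongrightarrow> \<beta>) (at_right 0)"

definition rate_limit :: "pt set \<Rightarrow> real \<Rightarrow> real \<Rightarrow> real \<Rightarrow> bool" where
  "rate_limit Z \<alpha> \<beta> L \<longleftrightarrow>
     (\<forall>N M. admissible \<alpha> \<beta> N M \<longrightarrow>
        ((\<lambda>p. ln (span_prob Z (N p) (M p) p) / ln p) \<longlongrightarrow> L) (at_right 0))"

definition rate :: "pt set \<Rightarrow> real \<Rightarrow> real \<Rightarrow> real" where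
  "rate Z \<alpha> \<beta> = (THE L. rate_limit Z \<alpha> \<beta> L)"

definition piecewise_linear_on :: "(real \<times> real) set \<Rightarrow> (real \<Rightarrow> real \<Rightarrow> real) \<Rightarrow> bool" where
  "piecewise_linear_on D f \<longleftrightarrow>
     (\<exists>\<P>. finite \<P> \<and> D = \<Union>\<P> \<and>
        (\<forall>P\<in>\<P>. polyhedron P \<and>
           (\<exists>c0 c1 c2. \<forall>(x,y)\<in>P. f x y = c0 + c1 * x + c2 * y)))"

end

theory Submission
  imports Defs
begin

text \<open>
  A pair of row and column counts outside \<open>Z\<close> is witnessed by at most \<open>k\<close> points in each of the two
  lines, where \<open>Z\<close> lies in a \<open>k \<times> k\<close> square. If the dynamics runs for long without stopping, pick one
  new point at each step. By pigeonhole many of them were created with the same witness sizes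
  \<open>(u, v)\<close>; a line carries at most \<open>k + 1\<close> picked points, since it is full once it has \<open>k\<close> of them. So the
  picked points meet \<open>k\<close> rows and \<open>k\<close> columns, and at the last of these times the whole \<open>k \<times> k\<close> grid
  they generate becomes occupied, which spans. Hence spanning takes bounded time, every spanning set
  contains a spanning subset of bounded size, and up to relabelling rows and columns there are only
  finitely many of these.

  The upper bound on the spanning probability is a union bound over the copies of the densest part of
  each of these finitely many sets, the lower bound is the second moment method for copies of one set.

  For the support: if \<open>\<rho>\<close> vanishes on \<open>A\<close>, applying it to the single rows and columns of \<open>A\<close> shows
  that strictly inside the region no point can be added to \<open>A\<close>. Outside the region, \<open>k\<close> rows with \<open>u\<close>
  points and \<open>k\<close> columns with \<open>v\<close> points form a spanning set all of whose nonempty parts are abundant.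
\<close>

section \<open>Bounded spanning time\<close>

text \<open>A copy of a finite set \<open>B\<close> in the box is fixed by the choice of its columns
  and rows, so about N^a M^b copies compete, a and b being the sizes of the two projections, and on
  the logarithmic scale their expected number is p to the power
  \<open>excess \<alpha> \<beta> B\<close>. A set appears only if all its parts do, so its cost is
  the largest excess among its parts, which is \<open>rho\<close>; the cheapest spanning set
  decides. The obstacle is that infinitely many spanning sets compete, and a union bound over all of
  them has no uniform control. A size bound depending only on \<open>Z\<close> supplies it, and
  makes the minimizing family independent of the weights. In the other direction a single optimal
  set suffices: in the second moment, two copies sharing a part contribute in inverse proportion to
  the expected number of copies of that part, and \<open>rho\<close> controls this for all parts at
  once.\<close>

lemma rect_eq: "rect a b = {..<a} \<times> {..<b}"
  by (auto simp: rect_def)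

lemma finite_rect: "finite (rect a b)"
  by (simp add: rect_eq)

text \<open>\<open>k\<close> is the side of any square containing \<open>Z\<close>; it serves as a
  number of points that always suffices to fill a line. Nonemptiness of \<open>Z\<close> enters as
  membership of the origin, which is equivalent under downward closure.\<close>

locale young_diagram =
  fixes Z :: "pt set" and k :: nat
  assumes down: "\<lbrakk>(u, v) \<in> Z; u' \<le> u; v' \<le> v\<rbrakk> \<Longrightarrow> (u', v') \<in> Z"
    and bound: "(u, v) \<in> Z \<Longrightarrow> u < k \<and> v < k"
    and zero_mem: "(0, 0) \<in> Z"
begin

lemma k_pos: "k > 0"
  using bound[OF zero_mem] by simp

text \<open>Finite witnesses of bounded size replace possibly infinite counts. If a line carries
  more than \<open>k\<close> points, \<open>k\<close> of them already give (k, 0) or (0, k), both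
  outside \<open>Z\<close>; otherwise the two full lines serve. Conversely, enlarging a pair outside
  \<open>Z\<close> keeps it outside by \<open>down\<close>.\<close>

lemma NG_iff:
  "x \<in> NG Z A \<longleftrightarrow> x \<in> A \<or> (\<exists>U V. finite U \<and> finite V \<and> U \<subseteq> row_pts x A \<and> V \<subseteq> col_pts x A
     \<and> card U \<le> k \<and> card V \<le> k \<and> (card U, card V) \<notin> Z)" (is "_ \<longleftrightarrow> _ \<or> ?R")
proof (cases "x \<in> A")
  case False
  have k0: "(k, 0) \<notin> Z" and k1: "(0, k) \<notin> Z"
    using bound by blast+
  have "?R" if new: "x \<in> NG Z A"
  proof -
    have large: "\<exists>U\<subseteq>X. finite U \<and> card U = k" if "\<not> (finite X \<and> card X \<le> k)" for X :: "pt set"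
    proof (cases "finite X")
      case True
      then have "k \<le> card X" using that by simp
      then show ?thesis by (meson obtain_subset_with_card_n)
    next
      case False
      then show ?thesis using infinite_arbitrarily_large by blast
    qed
    consider (r) U where "U \<subseteq> row_pts x A" "finite U" "card U = k"
      | (c) V where "V \<subseteq> col_pts x A" "finite V" "card V = k"
      | (s) "finite (row_pts x A)" "finite (col_pts x A)" "card (row_pts x A) \<le> k" "card (col_pts x A) \<le> k"
      using large by blast
    then show ?R
    proof cases
      case r
      then show ?thesis using k0 by (intro exI[of _ U] exI[of _ "{}"]) auto
    next
      case c
      then show ?thesis using k1 by (intro exI[of _ "{}"] exI[of _ V]) auto
    next
      case s
      then show ?thesis using new False unfolding NG_def
        by (intro exI[of _ "row_pts x A"] exI[of _ "col_pts x A"]) auto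
    qed
  qed
  moreover have "x \<in> NG Z A" if ?R
  proof -
    from that obtain U V where UV: "finite U" "finite V" "U \<subseteq> row_pts x A" "V \<subseteq> col_pts x A"
      "(card U, card V) \<notin> Z" by blast
    have "(card (row_pts x A), card (col_pts x A)) \<notin> Z"
      if "finite (row_pts x A)" "finite (col_pts x A)"
      using UV(5) down card_mono[OF that(1) UV(3)] card_mono[OF that(2) UV(4)] by blast
    then show ?thesis using False unfolding NG_def by auto
  qed
  ultimately show ?thesis using False by blast
qed (simp add: NG_def)

lemma NG_mono: "A \<subseteq> B \<Longrightarrow> NG Z A \<subseteq> NG Z B"
proof
  fix x assume AB: "A \<subseteq> B" and x: "x \<in> NG Z A"
  have sub: "row_pts x A \<subseteq> row_pts x B" "col_pts x A \<subseteq> col_pts x B"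
    using AB unfolding row_pts_def col_pts_def by auto
  show "x \<in> NG Z B"
  proof (cases "x \<in> A")
    case True
    then show ?thesis using AB by (auto simp: NG_def)
  next
    case False
    then obtain U V where "finite U" "finite V" "U \<subseteq> row_pts x A" "V \<subseteq> col_pts x A"
      "card U \<le> k" "card V \<le> k" "(card U, card V) \<notin> Z"
      using x NG_iff by auto
    then show ?thesis unfolding NG_iff using sub
      by (intro disjI2 exI[of _ U] exI[of _ V]) auto
  qed
qed

lemma subset_NG: "A \<subseteq> NG Z A"
  by (auto simp: NG_def)

lemma NG_iter_mono: "A \<subseteq> B \<Longrightarrow> (NG Z ^^ t) A \<subseteq> (NG Z ^^ t) B"
  by (induction t) (auto dest: NG_mono)

lemma NG_iter_increasing: "s \<le> t \<Longrightarrow> (NG Z ^^ s) A \<subseteq> (NG Z ^^ t) A"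
  by (induction t) (use subset_NG in \<open>auto simp: le_Suc_eq\<close>)

lemma spans_mono: "\<lbrakk>spans Z A; A \<subseteq> B\<rbrakk> \<Longrightarrow> spans Z B"
proof -
  assume "spans Z A" "A \<subseteq> B"
  moreover from this(2) have "(\<Union>t. (NG Z ^^ t) A) \<subseteq> (\<Union>t. (NG Z ^^ t) B)"
    by (intro UN_mono NG_iter_mono) auto
  ultimately show "spans Z B" unfolding spans_def by (simp add: top.extremum_uniqueI)
qed

lemma spans_if_NG_iter: "(NG Z ^^ t) A = UNIV \<Longrightarrow> spans Z A"
  unfolding spans_def using UN_upper[of t UNIV "\<lambda>t. (NG Z ^^ t) A"] by (simp add: top.extremum_uniqueI)

lemma row_full:
  assumes "finite P" "card P = k" "P \<subseteq> row_pts x A"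
  shows "x \<in> NG Z A"
proof -
  have "(k, 0) \<notin> Z" using bound by blast
  then show ?thesis unfolding NG_iff using assms
    by (intro disjI2 exI[of _ P] exI[of _ "{}"]) auto
qed

lemma col_full:
  assumes "finite P" "card P = k" "P \<subseteq> col_pts x A"
  shows "x \<in> NG Z A"
proof -
  have "(0, k) \<notin> Z" using bound by blast
  then show ?thesis unfolding NG_iff using assms
    by (intro disjI2 exI[of _ "{}"] exI[of _ P]) auto
qed

text \<open>Each row with height in \<open>Q\<close> already holds \<open>k\<close> points, so these
  rows fill in one step; then every column meets them in \<open>k\<close> points.\<close>

lemma grid_spans_in_two_steps:
  assumes P: "finite P" "card P = k" and Q: "finite Q" "card Q = k" and sub: "P \<times> Q \<subseteq> A"
  shows "NG Z (NG Z A) = UNIV"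
proof -
  have row: "x \<in> NG Z A" if "snd x \<in> Q" for x
  proof (rule row_full)
    show "finite (P \<times> {snd x})" "card (P \<times> {snd x}) = k" "P \<times> {snd x} \<subseteq> row_pts x A"
      using P sub that by (auto simp: row_pts_def card_cartesian_product)
  qed
  have "x \<in> NG Z (NG Z A)" for x
  proof (rule col_full)
    show "finite ({fst x} \<times> Q)" "card ({fst x} \<times> Q) = k" "{fst x} \<times> Q \<subseteq> col_pts x (NG Z A)"
      using Q row by (auto simp: col_pts_def card_cartesian_product)
  qed
  then show ?thesis by blast
qed

text \<open>There are \<open>(k + 1)\<^sup>2\<close> possible pairs of witness sizes, and
  \<open>k * (k + 1)\<close> steps with the same pair force \<open>k\<close> rows and
  \<open>k\<close> columns. The final 2 are the steps from a full grid to everything.\<close>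

definition span_time :: nat where
  "span_time = (k + 1)\<^sup>2 * (k * (k + 1)) + 2"

text \<open>No line receives more than \<open>k + 1\<close> of the picked points, so
  \<open>k * (k + 1)\<close> of them need at least \<open>k\<close> lines. The projection
  \<open>\<pi>\<close> stands for \<open>fst\<close> or \<open>snd\<close> and \<open>full\<close>
  for the matching filling rule, so that rows and columns share one argument.\<close>

lemma line_card_bound:
  fixes x :: "nat \<Rightarrow> pt" and \<pi> :: "pt \<Rightarrow> nat"
  assumes finH: "finite H" and new: "\<And>i. i \<in> H \<Longrightarrow> x i \<in> (NG Z ^^ Suc i) A - (NG Z ^^ i) A"
    and full: "\<And>z P B. \<lbrakk>finite P; card P = k; P \<subseteq> B; \<And>y. y \<in> P \<Longrightarrow> \<pi> y = \<pi> z\<rbrakk> \<Longrightarrow> z \<in> NG Z B"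
    and cH: "card H \<ge> k * (k + 1)"
  shows "card (\<pi> ` x ` H) \<ge> k"
proof -
  have less: "x j \<in> (NG Z ^^ i) A" if "j \<in> H" "j < i" for i j
    using new[OF that(1)] NG_iter_increasing[of "Suc j" i A] that(2) by auto
  have inj: "inj_on x H"
  proof (rule inj_onI)
    fix i j assume "i \<in> H" "j \<in> H" "x i = x j"
    then show "i = j"
      using less[of i j] less[of j i] new[of i] new[of j] by (metis DiffE linorder_neqE_nat)
  qed
  have line: "card {i \<in> H. \<pi> (x i) = r} \<le> k + 1" for r
  proof (rule ccontr)
    define G where "G = {i \<in> H. \<pi> (x i) = r}"
    assume "\<not> card {i \<in> H. \<pi> (x i) = r} \<le> k + 1"
    then have cG: "card G \<ge> k + 2" by (simp add: G_def)
    have finG: "finite G" using finH by (simp add: G_def)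
    \<comment> \<open>The \<open>k\<close> picks with index below \<open>m'\<close> are all present
      at time \<open>m'\<close>, so the line is full one step later, hence by time \<open>m\<close>,
      and \<open>x m\<close> is not new. With only \<open>k + 1\<close> picks the last of the
      \<open>k\<close> earlier ones could appear one step before \<open>x m\<close>, leaving no time
      to fill the line; hence the bound \<open>k + 1\<close>.\<close>
    define m where "m = Max G"
    define m' where "m' = Max (G - {m})"
    have m: "m \<in> G" unfolding m_def using finG cG by (intro Max_in) auto
    have c1: "card (G - {m}) \<ge> k + 1" using m cG finG by simp
    have "G - {m} \<noteq> {}" using c1 by (metis add_is_0 card.empty le_zero_eq one_neq_zero)
    then have m': "m' \<in> G - {m}" unfolding m'_def using finG by (intro Max_in) auto
    have mm: "m' < m" using m' Max_ge[OF finG, of m'] by (simp add: m_def)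
    have "card (G - {m} - {m'}) \<ge> k" using c1 m' finG by simp
    then obtain G' where G': "G' \<subseteq> G - {m} - {m'}" "card G' = k" "finite G'"
      by (meson obtain_subset_with_card_n)
    have lt: "j < m'" if "j \<in> G'" for j
    proof -
      have "j \<in> G - {m}" "j \<noteq> m'" using G' that by auto
      then show ?thesis using Max_ge[of "G - {m}" j] finG unfolding m'_def
        by (metis finite_Diff le_neq_implies_less)
    qed
    have GH: "G' \<subseteq> H" using G' G_def by auto
    have "x m \<in> NG Z ((NG Z ^^ m') A)"
    proof (rule full)
      show "finite (x ` G')" "card (x ` G') = k"
        using G' inj_on_subset[OF inj GH] by (auto simp: card_image)
      show "x ` G' \<subseteq> (NG Z ^^ m') A" using less lt GH by auto
      show "\<pi> y = \<pi> (x m)" if "y \<in> x ` G'" for y using that G' m by (auto simp: G_def)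
    qed
    then have "x m \<in> (NG Z ^^ m) A" using NG_iter_increasing[of "Suc m'" m A] mm by auto
    then show False using new[of m] m by (auto simp: G_def)
  qed
  have "card H \<le> (\<Sum>r\<in>\<pi> ` x ` H. card {i \<in> H. \<pi> (x i) = r})"
  proof -
    have "H = (\<Union>r\<in>\<pi> ` x ` H. {i \<in> H. \<pi> (x i) = r})" by auto
    then show ?thesis using card_UN_le[of "\<pi> ` x ` H" "\<lambda>r. {i \<in> H. \<pi> (x i) = r}"] finH by simp
  qed
  also have "\<dots> \<le> card (\<pi> ` x ` H) * (k + 1)"
    using sum_bounded_above[of "\<pi> ` x ` H" _ "k + 1"] line by simp
  finally have "k * (k + 1) \<le> card (\<pi> ` x ` H) * (k + 1)" using cH by linarith
  then show ?thesis by (rule mult_right_le_imp_le) simp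
qed

lemma spans_in_bounded_time:
  assumes "spans Z A"
  shows "(NG Z ^^ span_time) A = UNIV"
proof -
  define s where "s = (k + 1)\<^sup>2 * (k * (k + 1))"
  have st: "span_time = s + 2" by (simp add: span_time_def s_def)
  show ?thesis
  proof (cases "\<exists>i<s. (NG Z ^^ Suc i) A = (NG Z ^^ i) A")
    case True
    then obtain i where i: "i < s" "NG Z ((NG Z ^^ i) A) = (NG Z ^^ i) A" by auto
    have stable: "(NG Z ^^ (i + t)) A = (NG Z ^^ i) A" for t
      by (induction t) (use i in auto)
    have "(NG Z ^^ t) A \<subseteq> (NG Z ^^ i) A" for t
      using stable[of "t - i"] NG_iter_increasing[of t i A] by (cases "t \<le> i") auto
    then have "(NG Z ^^ i) A = UNIV" using assms unfolding spans_def by blast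
    then show ?thesis using stable[of "s + 2 - i"] i st by simp
  next
    case False
    have "\<exists>x U V. x \<in> (NG Z ^^ Suc i) A - (NG Z ^^ i) A \<and> finite U \<and> finite V
        \<and> U \<subseteq> row_pts x ((NG Z ^^ i) A) \<and> V \<subseteq> col_pts x ((NG Z ^^ i) A)
        \<and> card U \<le> k \<and> card V \<le> k \<and> (card U, card V) \<notin> Z" if "i < s" for i
    proof -
      have "(NG Z ^^ Suc i) A \<noteq> (NG Z ^^ i) A" using False that by blast
      then obtain x where x: "x \<in> (NG Z ^^ Suc i) A - (NG Z ^^ i) A"
        using NG_iter_increasing[of i "Suc i" A] by auto
      then have "x \<in> NG Z ((NG Z ^^ i) A)" "x \<notin> (NG Z ^^ i) A" by auto
      then show ?thesis using x unfolding NG_iff[of x "(NG Z ^^ i) A"] by blast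
    qed
    then have "\<forall>i\<in>{..<s}. \<exists>w. fst w \<in> (NG Z ^^ Suc i) A - (NG Z ^^ i) A
        \<and> finite (fst (snd w)) \<and> finite (snd (snd w))
        \<and> fst (snd w) \<subseteq> row_pts (fst w) ((NG Z ^^ i) A) \<and> snd (snd w) \<subseteq> col_pts (fst w) ((NG Z ^^ i) A)
        \<and> card (fst (snd w)) \<le> k \<and> card (snd (snd w)) \<le> k \<and> (card (fst (snd w)), card (snd (snd w))) \<notin> Z"
      by (metis fst_conv snd_conv lessThan_iff)
    from bchoice[OF this] obtain w where w: "\<And>i. i < s \<Longrightarrow> fst (w i) \<in> (NG Z ^^ Suc i) A - (NG Z ^^ i) A
        \<and> finite (fst (snd (w i))) \<and> finite (snd (snd (w i)))
        \<and> fst (snd (w i)) \<subseteq> row_pts (fst (w i)) ((NG Z ^^ i) A)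
        \<and> snd (snd (w i)) \<subseteq> col_pts (fst (w i)) ((NG Z ^^ i) A)
        \<and> card (fst (snd (w i))) \<le> k \<and> card (snd (snd (w i))) \<le> k
        \<and> (card (fst (snd (w i))), card (snd (snd (w i)))) \<notin> Z" by blast
    define x where "x i = fst (w i)" for i
    define U where "U i = fst (snd (w i))" for i
    define V where "V i = snd (snd (w i))" for i
    have new: "\<And>i. i < s \<Longrightarrow> x i \<in> (NG Z ^^ Suc i) A - (NG Z ^^ i) A"
      and fin: "\<And>i. i < s \<Longrightarrow> finite (U i) \<and> finite (V i)"
      and U: "\<And>i. i < s \<Longrightarrow> U i \<subseteq> row_pts (x i) ((NG Z ^^ i) A)"
      and V: "\<And>i. i < s \<Longrightarrow> V i \<subseteq> col_pts (x i) ((NG Z ^^ i) A)"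
      and card: "\<And>i. i < s \<Longrightarrow> card (U i) \<le> k \<and> card (V i) \<le> k \<and> (card (U i), card (V i)) \<notin> Z"
      unfolding x_def U_def V_def using w by blast+
    define f where "f i = (card (U i), card (V i))" for i
    have fim: "f \<in> {..<s} \<rightarrow> {..k} \<times> {..k}" using card by (auto simp: f_def)
    obtain uv where "uv \<in> {..k} \<times> {..k}"
      and big: "s \<le> card (f -` {uv} \<inter> {..<s}) * (k + 1)\<^sup>2"
      using pigeonhole_card[OF fim] by (auto simp: card_cartesian_product power2_eq_square)
    define H where "H = f -` {uv} \<inter> {..<s}"
    have finH: "finite H" by (simp add: H_def)
    have Hs: "i < s" "f i = uv" if "i \<in> H" for i using that by (auto simp: H_def)
    have "(k * (k + 1)) * (k + 1)\<^sup>2 \<le> card H * (k + 1)\<^sup>2"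
      using big unfolding H_def s_def by (simp only: mult.commute)
    then have cH: "card H \<ge> k * (k + 1)" by (simp only: mult_le_cancel2) auto
    have "H \<noteq> {}" using cH k_pos by auto
    define \<tau> where "\<tau> = Max H"
    have \<tau>: "\<tau> \<in> H" "\<And>i. i \<in> H \<Longrightarrow> i \<le> \<tau>"
      using finH \<open>H \<noteq> {}\<close> by (auto simp: \<tau>_def)
    have "card (fst ` x ` H) \<ge> k"
    proof (rule line_card_bound[OF finH _ _ cH])
      show "x i \<in> (NG Z ^^ Suc i) A - (NG Z ^^ i) A" if "i \<in> H" for i
        using new Hs(1)[OF that] .
      show "z \<in> NG Z B" if "finite P" "card P = k" "P \<subseteq> B" "\<And>y. y \<in> P \<Longrightarrow> fst y = fst z" for z P B
        by (rule col_full[OF that(1,2)]) (use that(3,4) in \<open>auto simp: col_pts_def\<close>)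
    qed
    then obtain P where P: "finite P" "card P = k" "P \<subseteq> fst ` x ` H"
      by (meson obtain_subset_with_card_n)
    have "card (snd ` x ` H) \<ge> k"
    proof (rule line_card_bound[OF finH _ _ cH])
      show "x i \<in> (NG Z ^^ Suc i) A - (NG Z ^^ i) A" if "i \<in> H" for i
        using new Hs(1)[OF that] .
      show "z \<in> NG Z B" if "finite P" "card P = k" "P \<subseteq> B" "\<And>y. y \<in> P \<Longrightarrow> snd y = snd z" for z P B
        by (rule row_full[OF that(1,2)]) (use that(3,4) in \<open>auto simp: row_pts_def\<close>)
    qed
    then obtain Q where Q: "finite Q" "card Q = k" "Q \<subseteq> snd ` x ` H"
      by (meson obtain_subset_with_card_n)
    have "P \<times> Q \<subseteq> (NG Z ^^ Suc \<tau>) A"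
    proof
      fix z assume "z \<in> P \<times> Q"
      then have "fst z \<in> fst ` x ` H" "snd z \<in> snd ` x ` H"
        using P(3) Q(3) by auto
      then obtain i j where ij: "i \<in> H" "j \<in> H" "fst z = fst (x i)" "snd z = snd (x j)"
        by blast
      \<comment> \<open>\<open>z\<close> shares its row with \<open>x j\<close> and its column with
        \<open>x i\<close>, so the row witness of \<open>x j\<close> and the column witness of
        \<open>x i\<close> both serve \<open>z\<close>, and both are present at time
        \<open>\<tau>\<close>. All indices in \<open>H\<close> have the same witness sizes, so the
        mixed pair of sizes is again \<open>uv\<close>, outside \<open>Z\<close>.\<close>
      have "U j \<subseteq> row_pts z ((NG Z ^^ \<tau>) A)"
        using U[of j] Hs[OF ij(2)] ij NG_iter_increasing[OF \<tau>(2)[OF ij(2)], of A]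
        by (auto simp: row_pts_def)
      moreover have "V i \<subseteq> col_pts z ((NG Z ^^ \<tau>) A)"
        using V[of i] Hs[OF ij(1)] ij NG_iter_increasing[OF \<tau>(2)[OF ij(1)], of A]
        by (auto simp: col_pts_def)
      moreover have "card (U i) = card (U j)"
        using Hs[OF ij(1)] Hs[OF ij(2)] by (simp add: f_def) auto
      ultimately have "z \<in> NG Z ((NG Z ^^ \<tau>) A)"
        unfolding NG_iff using fin[OF Hs(1)[OF ij(1)]] fin[OF Hs(1)[OF ij(2)]]
          card[OF Hs(1)[OF ij(1)]] card[OF Hs(1)[OF ij(2)]]
        by (intro disjI2 exI[of _ "U j"] exI[of _ "V i"]) simp
      then show "z \<in> (NG Z ^^ Suc \<tau>) A" by simp
    qed
    then have "NG Z (NG Z ((NG Z ^^ Suc \<tau>) A)) = UNIV"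
      using grid_spans_in_two_steps P Q by blast
    then have "(NG Z ^^ (\<tau> + 3)) A = UNIV" by (simp add: numeral_3_eq_3)
    moreover have "\<tau> + 3 \<le> span_time" using Hs(1)[OF \<tau>(1)] st by simp
    ultimately show ?thesis using NG_iter_increasing[of "\<tau> + 3" span_time A] by auto
  qed
qed

text \<open>Traced back one step, a new point rests on at most \<open>k\<close> points in its row
  and \<open>k\<close> in its column, so the number of its ancestors in \<open>A\<close> is at most
  a power of the branching number.\<close>

lemma NG_iter_witness:
  assumes "x \<in> (NG Z ^^ t) A"
  shows "\<exists>B\<subseteq>A. finite B \<and> card B \<le> (2 * k + 1) ^ t \<and> x \<in> (NG Z ^^ t) B"
  using assms
proof (induction t arbitrary: x)
  case 0
  then show ?case by (intro exI[of _ "{x}"]) auto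
next
  case (Suc t)
  show ?case
  proof (cases "x \<in> (NG Z ^^ t) A")
    case True
    then obtain B where "B \<subseteq> A" "finite B" "card B \<le> (2 * k + 1) ^ t" "x \<in> (NG Z ^^ t) B"
      using Suc.IH by blast
    moreover have "(2 * k + 1) ^ t \<le> (2 * k + 1) ^ Suc t" by simp
    ultimately show ?thesis using NG_iter_increasing[of t "Suc t" B]
      by (intro exI[of _ B]) auto
  next
    case False
    then obtain U V where UV: "finite U" "finite V" "U \<subseteq> row_pts x ((NG Z ^^ t) A)"
      "V \<subseteq> col_pts x ((NG Z ^^ t) A)" "card U \<le> k" "card V \<le> k" "(card U, card V) \<notin> Z"
      using Suc.prems NG_iff[of x "(NG Z ^^ t) A"] by auto
    have "y \<in> (NG Z ^^ t) A" if "y \<in> U \<union> V" for y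
      using UV that by (auto simp: row_pts_def col_pts_def)
    then have "\<forall>y\<in>U \<union> V. \<exists>B. B \<subseteq> A \<and> finite B \<and> card B \<le> (2 * k + 1) ^ t \<and> y \<in> (NG Z ^^ t) B"
      using Suc.IH by blast
    from bchoice[OF this] obtain B where B: "\<And>y. y \<in> U \<union> V \<Longrightarrow>
        B y \<subseteq> A \<and> finite (B y) \<and> card (B y) \<le> (2 * k + 1) ^ t \<and> y \<in> (NG Z ^^ t) (B y)"
      by blast
    define C where "C = (\<Union>y\<in>U \<union> V. B y)"
    have sub: "U \<union> V \<subseteq> (NG Z ^^ t) C"
    proof
      fix y assume y: "y \<in> U \<union> V"
      then have "B y \<subseteq> C" by (auto simp: C_def)
      then show "y \<in> (NG Z ^^ t) C" using NG_iter_mono B y by blast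
    qed
    have "U \<subseteq> row_pts x ((NG Z ^^ t) C)" "V \<subseteq> col_pts x ((NG Z ^^ t) C)"
      using UV sub by (auto simp: row_pts_def col_pts_def)
    then have "x \<in> (NG Z ^^ Suc t) C" using UV NG_iff[of x "(NG Z ^^ t) C"] by auto
    moreover have "C \<subseteq> A" "finite C" using B UV by (auto simp: C_def)
    moreover have "card C \<le> (2 * k + 1) ^ Suc t"
    proof -
      have "card C \<le> (\<Sum>y\<in>U \<union> V. card (B y))"
        unfolding C_def using UV by (intro card_UN_le) auto
      also have "\<dots> \<le> card (U \<union> V) * (2 * k + 1) ^ t"
        using B sum_bounded_above[of "U \<union> V" "\<lambda>y. card (B y)"] by simp
      also have "\<dots> \<le> (2 * k + 1) * (2 * k + 1) ^ t"
        using UV card_Un_le[of U V] by (intro mult_right_mono) auto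
      finally show ?thesis by simp
    qed
    ultimately show ?thesis by blast
  qed
qed

text \<open>The square \<open>rect k k\<close> has \<open>k * k\<close> cells, each resting on at
  most \<open>(2 * k + 1) ^ span_time\<close> initial points.\<close>

definition witness_size :: nat where
  "witness_size = k * k * (2 * k + 1) ^ span_time"

lemma rect_spans: "spans Z (rect k k)"
proof -
  have "{..<k} \<times> {..<k} \<subseteq> rect k k" by (auto simp: rect_def)
  then have "NG Z (NG Z (rect k k)) = UNIV"
    by (intro grid_spans_in_two_steps[of "{..<k}" "{..<k}"]) auto
  then have "(NG Z ^^ 2) (rect k k) = UNIV" by (simp add: numeral_2_eq_2)
  then show ?thesis by (rule spans_if_NG_iter)
qed

text \<open>Only the square \<open>rect k k\<close> has to be reproduced, since it spans by itself;
  the witnesses of its cells together form a small set. The common time \<open>span_time\<close> for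
  all cells is what makes the size uniform in \<open>A\<close>.\<close>

lemma spans_has_small_subset:
  assumes "spans Z A"
  shows "\<exists>B\<subseteq>A. finite B \<and> card B \<le> witness_size \<and> spans Z B"
proof -
  have "\<exists>B\<subseteq>A. finite B \<and> card B \<le> (2 * k + 1) ^ span_time \<and> x \<in> (NG Z ^^ span_time) B" for x
    by (rule NG_iter_witness) (simp add: spans_in_bounded_time[OF assms])
  then have "\<forall>x. \<exists>B. B \<subseteq> A \<and> finite B \<and> card B \<le> (2 * k + 1) ^ span_time \<and> x \<in> (NG Z ^^ span_time) B"
    by blast
  from choice[OF this] obtain B where B: "\<And>x. B x \<subseteq> A \<and> finite (B x) \<and> card (B x) \<le> (2 * k + 1) ^ span_time
     \<and> x \<in> (NG Z ^^ span_time) (B x)" by blast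
  define C where "C = (\<Union>x\<in>rect k k. B x)"
  have fin: "finite (rect k k)" "card (rect k k) = k * k"
    by (auto simp: rect_eq card_cartesian_product)
  have "card C \<le> (\<Sum>x\<in>rect k k. card (B x))"
    unfolding C_def using fin by (intro card_UN_le) auto
  also have "\<dots> \<le> witness_size"
    using B sum_bounded_above[of "rect k k" "\<lambda>x. card (B x)"] fin by (simp add: witness_size_def)
  finally have "card C \<le> witness_size" .
  moreover have "finite C" "C \<subseteq> A" using B fin by (auto simp: C_def)
  moreover have "spans Z C"
  proof -
    have "rect k k \<subseteq> (NG Z ^^ span_time) C"
    proof
      fix x assume "x \<in> rect k k"
      then have "B x \<subseteq> C" by (auto simp: C_def)
      then show "x \<in> (NG Z ^^ span_time) C" using NG_iter_mono B by blast
    qed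
    then have "spans Z ((NG Z ^^ span_time) C)" by (rule spans_mono[OF rect_spans])
    \<comment> \<open>Spanning from a later state of \<open>C\<close> is turned into a fixed time by
      the time bound; the two times then add up to a single iterate of \<open>C\<close>.\<close>
    then have "(NG Z ^^ span_time) ((NG Z ^^ span_time) C) = UNIV"
      by (rule spans_in_bounded_time)
    then have "(NG Z ^^ (span_time + span_time)) C = UNIV"
      by (simp only: funpow_add comp_apply)
    then show ?thesis by (rule spans_if_NG_iter)
  qed
  ultimately show ?thesis by blast
qed

end

section \<open>Relabelling and the finite basis\<close>

text \<open>The complements of \<open>X\<close> and of its image are infinite sets of naturals, so
  their enumerations match them up. An extension to the entire axis is needed because the dynamics
  creates points in rows and columns that a given finite set does not meet.\<close>

lemma finite_inj_extends_to_bij: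
  fixes f :: "nat \<Rightarrow> nat"
  assumes "finite X" "inj_on f X"
  shows "\<exists>\<sigma>. bij \<sigma> \<and> (\<forall>x\<in>X. \<sigma> x = f x)"
proof -
  have inf: "infinite (- X)" "infinite (- (f ` X))"
    using assms by (simp_all add: Compl_eq_Diff_UNIV Diff_infinite_finite)
  define h where "h = enumerate (- (f ` X)) \<circ> the_inv_into UNIV (enumerate (- X))"
  have "bij_betw h (- X) (- (f ` X))" unfolding h_def
    using bij_betw_the_inv_into[OF bij_enumerate[OF inf(1)]] bij_enumerate[OF inf(2)]
    by (rule bij_betw_trans)
  moreover have "bij_betw f X (f ` X)" using assms by (simp add: inj_on_imp_bij_betw)
  ultimately have "bij_betw (\<lambda>x. if x \<in> X then f x else h x) (X \<union> - X) (f ` X \<union> - (f ` X))"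
    by (intro bij_betw_disjoint_Un) auto
  then show ?thesis by (intro exI[of _ "\<lambda>x. if x \<in> X then f x else h x"]) (simp add: Compl_partition)
qed

lemma bij_map_prod:
  assumes "bij \<sigma>" "bij \<tau>"
  shows "bij (map_prod \<sigma> \<tau>)"
  using assms unfolding bij_def by (simp add: prod.inj_map map_prod_surj)

lemma NG_bij_image:
  assumes "bij \<sigma>" "bij \<tau>"
  shows "NG Z (map_prod \<sigma> \<tau> ` A) = map_prod \<sigma> \<tau> ` NG Z A"
proof -
  let ?m = "map_prod \<sigma> \<tau>"
  have m: "inj ?m" "surj ?m" using bij_map_prod[OF assms] by (auto simp: bij_def)
  have row: "row_pts (?m y) (?m ` A) = ?m ` row_pts y A" for y
    using assms by (auto simp: row_pts_def bij_def inj_eq)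
  have col: "col_pts (?m y) (?m ` A) = ?m ` col_pts y A" for y
    using assms by (auto simp: col_pts_def bij_def inj_eq)
  have c: "card (?m ` X) = card X" "finite (?m ` X) = finite X" for X
    using m(1) by (auto simp: card_image inj_on_subset finite_image_iff)
  have iff: "?m y \<in> NG Z (?m ` A) \<longleftrightarrow> y \<in> NG Z A" for y
    by (simp only: NG_def Un_iff mem_Collect_eq row col c inj_image_mem_iff[OF m(1)])
  show ?thesis
  proof (rule set_eqI)
    fix x
    obtain y where "x = ?m y" using m(2) by (rule surjE)
    then show "x \<in> NG Z (?m ` A) \<longleftrightarrow> x \<in> ?m ` NG Z A"
      by (simp only: iff inj_image_mem_iff[OF m(1)])
  qed
qed

lemma spans_bij_image:
  assumes "bij \<sigma>" "bij \<tau>"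
  shows "spans Z (map_prod \<sigma> \<tau> ` A) \<longleftrightarrow> spans Z A"
proof -
  let ?m = "map_prod \<sigma> \<tau>"
  have "(NG Z ^^ t) (?m ` A) = ?m ` ((NG Z ^^ t) A)" for t
    by (induction t) (simp_all add: NG_bij_image[OF assms])
  then have "spans Z (?m ` A) \<longleftrightarrow> ?m ` (\<Union>t. (NG Z ^^ t) A) = ?m ` UNIV"
    unfolding spans_def using bij_map_prod[OF assms] by (simp add: image_UN bij_def)
  also have "\<dots> \<longleftrightarrow> spans Z A"
    unfolding spans_def by (simp only: inj_image_eq_iff[OF bij_is_inj[OF bij_map_prod[OF assms]]])
  finally show ?thesis .
qed

lemma spans_inj_image:
  assumes "finite A" "inj_on f (fst ` A)" "inj_on g (snd ` A)"
  shows "spans Z (map_prod f g ` A) \<longleftrightarrow> spans Z A"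
proof -
  obtain \<sigma> where \<sigma>: "bij \<sigma>" "\<forall>x\<in>fst ` A. \<sigma> x = f x"
    using finite_inj_extends_to_bij[of "fst ` A" f] assms by auto
  obtain \<tau> where \<tau>: "bij \<tau>" "\<forall>x\<in>snd ` A. \<tau> x = g x"
    using finite_inj_extends_to_bij[of "snd ` A" g] assms by auto
  have "map_prod f g ` A = map_prod \<sigma> \<tau> ` A"
    using \<sigma>(2) \<tau>(2) by (intro image_cong refl) (simp add: prod_eq_iff)
  then show ?thesis using spans_bij_image \<sigma> \<tau> by simp
qed

lemma inj_on_map_prod_proj:
  assumes "inj_on f (fst ` A)" "inj_on g (snd ` A)"
  shows "inj_on (map_prod f g) A"
  by (rule inj_on_subset[OF map_prod_inj_on[OF assms]]) force

definition excess :: "real \<Rightarrow> real \<Rightarrow> pt set \<Rightarrow> real" where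
  "excess \<alpha> \<beta> B = real (card B) - \<alpha> * real (card (fst ` B)) - \<beta> * real (card (snd ` B))"

lemma rho_excess: "rho \<alpha> \<beta> A = Max (excess \<alpha> \<beta> ` Pow A)"
  by (simp add: rho_def excess_def[abs_def])

lemma excess_empty [simp]: "excess \<alpha> \<beta> {} = 0"
  by (simp add: excess_def)

lemma excess_le_rho: "\<lbrakk>finite A; B \<subseteq> A\<rbrakk> \<Longrightarrow> excess \<alpha> \<beta> B \<le> rho \<alpha> \<beta> A"
  unfolding rho_excess by (intro Max_ge) auto

lemma rho_attained:
  assumes "finite A"
  obtains B where "B \<subseteq> A" "rho \<alpha> \<beta> A = excess \<alpha> \<beta> B"
proof -
  have "Max (excess \<alpha> \<beta> ` Pow A) \<in> excess \<alpha> \<beta> ` Pow A"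
    using assms by (intro Max_in) auto
  then show ?thesis using that unfolding rho_excess by auto
qed

lemma rho_nonneg: "finite A \<Longrightarrow> 0 \<le> rho \<alpha> \<beta> A"
  using excess_le_rho[of A "{}" \<alpha> \<beta>] by simp

lemma rho_mono: "\<lbrakk>finite A; B \<subseteq> A\<rbrakk> \<Longrightarrow> rho \<alpha> \<beta> B \<le> rho \<alpha> \<beta> A"
  by (metis excess_le_rho finite_subset order_trans rho_attained)

lemma excess_inj_image:
  assumes "inj_on f (fst ` B)" "inj_on g (snd ` B)"
  shows "excess \<alpha> \<beta> (map_prod f g ` B) = excess \<alpha> \<beta> B"
proof -
  have "fst ` map_prod f g ` B = f ` fst ` B" "snd ` map_prod f g ` B = g ` snd ` B"
    by (auto simp: image_image)
  then show ?thesis unfolding excess_def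
    using assms card_image[OF inj_on_map_prod_proj[OF assms]] by (simp add: card_image)
qed

lemma rho_inj_image:
  assumes "inj_on f (fst ` A)" "inj_on g (snd ` A)"
  shows "rho \<alpha> \<beta> (map_prod f g ` A) = rho \<alpha> \<beta> A"
proof -
  have "excess \<alpha> \<beta> (map_prod f g ` B) = excess \<alpha> \<beta> B" if "B \<subseteq> A" for B
    by (rule excess_inj_image) (meson assms image_mono inj_on_subset that)+
  then have "excess \<alpha> \<beta> ` Pow (map_prod f g ` A) = excess \<alpha> \<beta> ` Pow A"
    unfolding image_Pow_surj[OF refl, symmetric] image_image by (intro image_cong) auto
  then show ?thesis by (simp add: rho_excess)
qed

context young_diagram
begin

text \<open>A spanning set with at most \<open>witness_size\<close> points can be relabelled into
  this square, so every spanning set contains a copy of a member. The weights do not occur, which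
  gives the independence of \<open>\<alpha>\<close> and \<open>\<beta>\<close>.\<close>

definition basis :: "pt set set" where
  "basis = {A. A \<subseteq> rect witness_size witness_size \<and> spans Z A}"

lemma finite_basis: "finite basis"
  unfolding basis_def by (rule finite_subset[of _ "Pow (rect witness_size witness_size)"])
    (auto simp: finite_rect)

lemma basisD: "A \<in> basis \<Longrightarrow> finite A \<and> spans Z A"
  unfolding basis_def using finite_rect finite_subset by auto

text \<open>A small spanning subset \<open>B\<close> is compressed by numbering its columns and rows
  from 0, which lands in the square because a projection of \<open>B\<close> has at most as many
  points as \<open>B\<close>; the maps returned undo the numbering.\<close>

lemma spans_contains_basis_copy:
  assumes "spans Z S"
  obtains A f g where "A \<in> basis" "inj_on f (fst ` A)" "inj_on g (snd ` A)" "map_prod f g ` A \<subseteq> S"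
proof -
  obtain B where B: "B \<subseteq> S" "finite B" "card B \<le> witness_size" "spans Z B"
    using spans_has_small_subset[OF assms] by blast
  obtain f where f: "bij_betw f (fst ` B) {0..<card (fst ` B)}"
    using ex_bij_betw_finite_nat[of "fst ` B"] B by auto
  obtain g where g: "bij_betw g (snd ` B) {0..<card (snd ` B)}"
    using ex_bij_betw_finite_nat[of "snd ` B"] B by auto
  have inj: "inj_on f (fst ` B)" "inj_on g (snd ` B)" using f g by (auto simp: bij_betw_def)
  define A where "A = map_prod f g ` B"
  have fsA: "fst ` A = f ` fst ` B" "snd ` A = g ` snd ` B"
    by (auto simp: A_def image_image)
  have "A \<subseteq> rect witness_size witness_size"
  proof
    fix x assume x: "x \<in> A"
    then have "fst x \<in> f ` fst ` B" "snd x \<in> g ` snd ` B" using fsA by blast+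
    then have "fst x < card (fst ` B)" "snd x < card (snd ` B)"
      using f g by (auto simp: bij_betw_def)
    moreover have "card (fst ` B) \<le> card B" "card (snd ` B) \<le> card B" using B by (auto intro: card_image_le)
    ultimately show "x \<in> rect witness_size witness_size" using B(3) by (simp add: rect_def)
  qed
  moreover have "spans Z A" unfolding A_def using spans_inj_image[OF B(2) inj] B(4) by simp
  ultimately have "A \<in> basis" by (simp add: basis_def)
  moreover have "inj_on (the_inv_into (fst ` B) f) (fst ` A)" "inj_on (the_inv_into (snd ` B) g) (snd ` A)"
    unfolding fsA using inj by (auto intro: inj_on_the_inv_into)
  moreover have "map_prod (the_inv_into (fst ` B) f) (the_inv_into (snd ` B) g) ` A = B"
  proof -
    have "map_prod (the_inv_into (fst ` B) f) (the_inv_into (snd ` B) g) (map_prod f g x) = x"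
      if "x \<in> B" for x
      using that inj by (simp add: prod_eq_iff the_inv_into_f_f)
    then show ?thesis unfolding A_def image_image by simp
  qed
  ultimately show ?thesis using that B(1) by simp
qed

lemma basis_nonempty: "basis \<noteq> {}"
  by (rule spans_contains_basis_copy[OF rect_spans]) auto

definition rate_fun :: "real \<Rightarrow> real \<Rightarrow> real" where
  "rate_fun \<alpha> \<beta> = Min (rho \<alpha> \<beta> ` basis)"

lemma rate_fun_attained:
  obtains A where "A \<in> basis" "rate_fun \<alpha> \<beta> = rho \<alpha> \<beta> A"
proof -
  have "rate_fun \<alpha> \<beta> \<in> rho \<alpha> \<beta> ` basis"
    unfolding rate_fun_def using finite_basis basis_nonempty by (intro Min_in) auto
  then show ?thesis using that by auto
qed

text \<open>\<open>A\<close> contains a relabelled basis member; relabelling preserves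
  \<open>rho\<close>, and passing to a subset does not increase it.\<close>

lemma rate_fun_le_rho:
  assumes "finite A" "spans Z A"
  shows "rate_fun \<alpha> \<beta> \<le> rho \<alpha> \<beta> A"
proof -
  obtain C f g where C: "C \<in> basis" "inj_on f (fst ` C)" "inj_on g (snd ` C)" "map_prod f g ` C \<subseteq> A"
    using spans_contains_basis_copy[OF assms(2)] .
  have "rate_fun \<alpha> \<beta> \<le> rho \<alpha> \<beta> C"
    unfolding rate_fun_def using finite_basis C by (intro Min_le) auto
  also have "\<dots> = rho \<alpha> \<beta> (map_prod f g ` C)" using C by (simp add: rho_inj_image)
  also have "\<dots> \<le> rho \<alpha> \<beta> A" using C assms by (intro rho_mono)
  finally show ?thesis .
qed

lemma rate_fun_nonneg: "0 \<le> rate_fun \<alpha> \<beta>"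
  by (rule rate_fun_attained[of \<alpha> \<beta>]) (simp add: basisD rho_nonneg)

lemma rate_fun_eq_Inf: "rate_fun \<alpha> \<beta> = Inf {rho \<alpha> \<beta> A | A. finite A \<and> spans Z A}"
proof (rule cInf_eq_minimum[symmetric])
  show "rate_fun \<alpha> \<beta> \<in> {rho \<alpha> \<beta> A | A. finite A \<and> spans Z A}"
    by (rule rate_fun_attained[of \<alpha> \<beta>]) (use basisD in auto)
qed (use rate_fun_le_rho in auto)

end

section \<open>Bounds on the spanning probability\<close>

definition bernoulli_weight :: "'a set \<Rightarrow> real \<Rightarrow> 'a set \<Rightarrow> real" where
  "bernoulli_weight V p S = p ^ card S * (1 - p) ^ (card V - card S)"

lemma bernoulli_weight_nonneg: "\<lbrakk>0 \<le> p; p \<le> 1\<rbrakk> \<Longrightarrow> 0 \<le> bernoulli_weight V p S"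
  by (simp add: bernoulli_weight_def)

text \<open>Writing \<open>S\<close> as \<open>F\<close> plus a subset \<open>T\<close> of the rest
  factors out \<open>p ^ card F\<close>; the sum over \<open>T\<close> expands a product of factors
  p + (1 - p), hence is 1.\<close>

lemma bernoulli_superset_prob:
  assumes V: "finite V" and F: "F \<subseteq> V"
  shows "(\<Sum>S | F \<subseteq> S \<and> S \<subseteq> V. bernoulli_weight V p S) = p ^ card F"
proof -
  have finF: "finite F" using V F finite_subset by blast
  have "(\<Sum>S | F \<subseteq> S \<and> S \<subseteq> V. bernoulli_weight V p S)
      = (\<Sum>T\<in>Pow (V - F). p ^ card F * (p ^ card T * (1 - p) ^ card (V - F - T)))"
  proof (rule sum.reindex_bij_witness[where i = "\<lambda>T. F \<union> T" and j = "\<lambda>S. S - F"])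
    fix S assume "S \<in> {S. F \<subseteq> S \<and> S \<subseteq> V}"
    then have S: "F \<subseteq> S" "S \<subseteq> V" by auto
    then have fS: "finite S" using V finite_subset by blast
    have "V - F - (S - F) = V - S" using S by auto
    moreover have "card S = card F + card (S - F)"
      using S fS finF by (metis Diff_partition card_Diff_subset card_mono le_add_diff_inverse)
    moreover have "card (V - S) = card V - card S" using S fS by (simp add: card_Diff_subset)
    ultimately show "p ^ card F * (p ^ card (S - F) * (1 - p) ^ card (V - F - (S - F))) = bernoulli_weight V p S"
      by (simp add: bernoulli_weight_def power_add)
  qed (use F in auto)
  also have "\<dots> = p ^ card F * (\<Sum>T\<in>Pow (V - F). (\<Prod>x\<in>T. p) * (\<Prod>x\<in>V - F - T. 1 - p))"
    by (simp add: sum_distrib_left)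
  also have "(\<Sum>T\<in>Pow (V - F). (\<Prod>x\<in>T. p) * (\<Prod>x\<in>V - F - T. 1 - p)) = (\<Prod>x\<in>V - F. p + (1 - p))"
    using V by (intro prod_add[symmetric]) simp
  finally show ?thesis by simp
qed

lemma bernoulli_union_bound:
  assumes V: "finite V" and p: "0 \<le> p" "p \<le> 1" and I: "finite I"
    and E: "\<And>S. S \<in> E \<Longrightarrow> S \<subseteq> V \<and> (\<exists>i\<in>I. F i \<subseteq> S)" and F: "\<And>i. i \<in> I \<Longrightarrow> F i \<subseteq> V"
  shows "sum (bernoulli_weight V p) E \<le> (\<Sum>i\<in>I. p ^ card (F i))"
proof -
  let ?w = "bernoulli_weight V p"
  have w: "0 \<le> ?w S" for S using p by (rule bernoulli_weight_nonneg)
  have finE: "finite E" using E V by (intro finite_subset[of E "Pow V"]) auto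
  have "sum ?w E \<le> (\<Sum>S\<in>E. \<Sum>i\<in>I. if F i \<subseteq> S then ?w S else 0)"
  proof (rule sum_mono)
    fix S assume "S \<in> E"
    then obtain i where i: "i \<in> I" "F i \<subseteq> S" using E by blast
    have "?w S = (if F i \<subseteq> S then ?w S else 0)" using i by simp
    also have "\<dots> \<le> (\<Sum>i\<in>I. if F i \<subseteq> S then ?w S else 0)"
      using i I w by (intro member_le_sum) auto
    finally show "?w S \<le> (\<Sum>i\<in>I. if F i \<subseteq> S then ?w S else 0)" .
  qed
  also have "\<dots> = (\<Sum>i\<in>I. \<Sum>S\<in>E. if F i \<subseteq> S then ?w S else 0)" by (rule sum.swap)
  also have "\<dots> \<le> (\<Sum>i\<in>I. p ^ card (F i))"
  proof (rule sum_mono)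
    fix i assume i: "i \<in> I"
    have "(\<Sum>S\<in>E. if F i \<subseteq> S then ?w S else 0) = sum ?w {S \<in> E. F i \<subseteq> S}"
      using finE by (simp add: sum.If_cases Int_def)
    also have "\<dots> \<le> sum ?w {S. F i \<subseteq> S \<and> S \<subseteq> V}"
      using V E w by (intro sum_mono2) auto
    also have "\<dots> = p ^ card (F i)" using bernoulli_superset_prob[OF V F[OF i]] .
    finally show "(\<Sum>S\<in>E. if F i \<subseteq> S then ?w S else 0) \<le> p ^ card (F i)" .
  qed
  finally show ?thesis .
qed

text \<open>\<open>X S\<close> counts the indices whose set lies in \<open>S\<close>, and vanishes
  off \<open>E\<close>. By Cauchy-Schwarz on \<open>E\<close>, its squared mean is at most the
  probability of \<open>E\<close> times its second moment, and two sets lie in \<open>S\<close>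
  together exactly when their union does.\<close>

lemma bernoulli_second_moment:
  assumes V: "finite V" and p: "0 \<le> p" "p \<le> 1" and I: "finite I"
    and F: "\<And>i. i \<in> I \<Longrightarrow> F i \<subseteq> V"
    and E: "\<And>S i. \<lbrakk>S \<subseteq> V; i \<in> I; F i \<subseteq> S\<rbrakk> \<Longrightarrow> S \<in> E" and EV: "E \<subseteq> Pow V"
  shows "(\<Sum>i\<in>I. p ^ card (F i))\<^sup>2
    \<le> sum (bernoulli_weight V p) E * (\<Sum>i\<in>I. \<Sum>j\<in>I. p ^ card (F i \<union> F j))"
proof -
  let ?w = "bernoulli_weight V p"
  define X where "X S = (\<Sum>i\<in>I. if F i \<subseteq> S then 1 else 0 :: real)" for S
  have w: "0 \<le> ?w S" for S using p by (rule bernoulli_weight_nonneg)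
  have fin: "finite (Pow V)" "finite E" using V EV finite_subset by auto
  have X0: "X S = 0" if "S \<in> Pow V - E" for S
    unfolding X_def using E that by (intro sum.neutral) auto
  have mean: "(\<Sum>S\<in>Pow V. ?w S * (if G \<subseteq> S then 1 else 0)) = p ^ card G" if "G \<subseteq> V" for G
  proof -
    have "(\<Sum>S\<in>Pow V. ?w S * (if G \<subseteq> S then 1 else 0)) = (\<Sum>S\<in>Pow V. if G \<subseteq> S then ?w S else 0)"
      by (intro sum.cong) auto
    also have "\<dots> = sum ?w {S. G \<subseteq> S \<and> S \<subseteq> V}"
      using fin by (simp add: sum.If_cases) (metis Collect_conj_eq Int_commute Pow_def)
    finally show ?thesis using bernoulli_superset_prob[OF V that] by simp
  qed
  have "(\<Sum>i\<in>I. p ^ card (F i)) = (\<Sum>S\<in>Pow V. ?w S * X S)"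
    unfolding X_def sum_distrib_left
    by (subst sum.swap) (use mean F in \<open>auto intro!: sum.cong\<close>)
  also have "\<dots> = (\<Sum>S\<in>E. ?w S * X S)"
    using fin EV X0 by (intro sum.mono_neutral_right) auto
  also have "\<dots> = (\<Sum>S\<in>E. sqrt (?w S) * (sqrt (?w S) * X S))"
    using w by (intro sum.cong) (auto simp: mult.assoc[symmetric])
  finally have "(\<Sum>i\<in>I. p ^ card (F i))\<^sup>2 = (\<Sum>S\<in>E. sqrt (?w S) * (sqrt (?w S) * X S))\<^sup>2" by simp
  also have "\<dots> \<le> (\<Sum>S\<in>E. (sqrt (?w S))\<^sup>2) * (\<Sum>S\<in>E. (sqrt (?w S) * X S)\<^sup>2)"
    by (rule Cauchy_Schwarz_ineq_sum)
  also have "(\<Sum>S\<in>E. (sqrt (?w S))\<^sup>2) = sum ?w E" using w by simp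
  also have "(\<Sum>S\<in>E. (sqrt (?w S) * X S)\<^sup>2) = (\<Sum>S\<in>E. ?w S * (X S)\<^sup>2)"
    using w by (simp add: power_mult_distrib)
  also have "(\<Sum>S\<in>E. ?w S * (X S)\<^sup>2) = (\<Sum>S\<in>Pow V. ?w S * (X S)\<^sup>2)"
    using fin EV X0 by (intro sum.mono_neutral_left) auto
  also have "\<dots> = (\<Sum>S\<in>Pow V. \<Sum>i\<in>I. \<Sum>j\<in>I. ?w S * (if F i \<union> F j \<subseteq> S then 1 else 0))"
  proof (rule sum.cong[OF refl])
    fix S
    have "(X S)\<^sup>2 = (\<Sum>i\<in>I. \<Sum>j\<in>I. (if F i \<subseteq> S then 1 else 0) * (if F j \<subseteq> S then 1 else 0))"
      unfolding X_def power2_eq_square sum_product ..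
    also have "\<dots> = (\<Sum>i\<in>I. \<Sum>j\<in>I. if F i \<union> F j \<subseteq> S then 1 else 0)"
      by (intro sum.cong) auto
    finally show "?w S * (X S)\<^sup>2 = (\<Sum>i\<in>I. \<Sum>j\<in>I. ?w S * (if F i \<union> F j \<subseteq> S then 1 else 0))"
      by (simp only: sum_distrib_left)
  qed
  also have "\<dots> = (\<Sum>i\<in>I. \<Sum>j\<in>I. \<Sum>S\<in>Pow V. ?w S * (if F i \<union> F j \<subseteq> S then 1 else 0))"
    by (subst sum.swap, rule sum.cong[OF refl], subst sum.swap, rule refl)
  also have "\<dots> = (\<Sum>i\<in>I. \<Sum>j\<in>I. p ^ card (F i \<union> F j))"
    using F by (intro sum.cong[OF refl] mean) auto
  finally show ?thesis .
qed

lemma span_prob_eq: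
  "span_prob Z N M p = sum (bernoulli_weight (rect N M) p) {S. S \<subseteq> rect N M \<and> spans Z S}"
  by (simp add: span_prob_def bernoulli_weight_def rect_eq card_cartesian_product)

text \<open>Given \<open>f\<close>, agreement on \<open>L\<close> leaves only the values of
  \<open>f'\<close> off \<open>L\<close> free. The power of \<open>n\<close> stands on the left to
  avoid division of naturals.\<close>

lemma card_agreeing_pairs:
  fixes n :: nat
  assumes L: "L \<subseteq> {..<K}"
  shows "card {(f, f') \<in> ({..<K} \<rightarrow>\<^sub>E {..<n}) \<times> ({..<K} \<rightarrow>\<^sub>E {..<n}). \<forall>i\<in>L. f i = f' i} * n ^ card L
    \<le> n ^ K * n ^ K"
proof -
  define D where "D = {..<K} \<rightarrow>\<^sub>E {..<n}"
  have finD: "finite D" by (auto simp: D_def intro: finite_PiE)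
  have finL: "finite L" using L finite_subset by blast
  have cD: "card D = n ^ K" by (simp add: D_def card_PiE)
  let ?S = "{(f, f') \<in> D \<times> D. \<forall>i\<in>L. f i = f' i}"
  let ?R = "({..<K} - L) \<rightarrow>\<^sub>E {..<n}"
  let ?h = "\<lambda>(f, f'). (f, restrict f' ({..<K} - L))"
  have "card ?S \<le> card (D \<times> ?R)"
  proof (rule card_inj_on_le)
    show "inj_on ?h ?S"
    proof (rule inj_onI)
      fix x y assume xy: "x \<in> ?S" "y \<in> ?S" "?h x = ?h y"
      obtain f f' g g' where [simp]: "x = (f, f')" "y = (g, g')" by (cases x, cases y)
      have *: "f = g" "f' \<in> D" "g' \<in> D" "\<forall>i\<in>L. f' i = g' i"
        "restrict f' ({..<K} - L) = restrict g' ({..<K} - L)" using xy by auto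
      have "f' = g'"
      proof (rule PiE_ext)
        show "f' \<in> {..<K} \<rightarrow>\<^sub>E {..<n}" "g' \<in> {..<K} \<rightarrow>\<^sub>E {..<n}" using * by (auto simp: D_def)
        show "f' i = g' i" if "i \<in> {..<K}" for i
        proof (cases "i \<in> L")
          case True
          then show ?thesis using * by simp
        next
          case False
          then show ?thesis using that fun_cong[OF *(5), of i] by simp
        qed
      qed
      then show "x = y" using *(1) by simp
    qed
    show "?h ` ?S \<subseteq> D \<times> ?R" by (auto simp: D_def PiE_def Pi_def restrict_def extensional_def)
    show "finite (D \<times> ?R)" using finD by (auto intro: finite_PiE)
  qed
  also have "card (D \<times> ?R) = n ^ K * n ^ (K - card L)"
    using L finL by (simp add: card_cartesian_product cD card_PiE card_Diff_subset)
  finally have "card ?S * n ^ card L \<le> n ^ K * n ^ (K - card L) * n ^ card L" by (rule mult_right_mono) simp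
  also have "\<dots> = n ^ K * n ^ K"
    using card_mono[OF finite_lessThan L] by (simp add: mult.assoc flip: power_add)
  finally show ?thesis by (simp add: D_def)
qed


lemma sum_agreeing_pairs:
  fixes n :: nat
  assumes L: "L \<subseteq> {..<K}"
  shows "(\<Sum>f\<in>{..<K} \<rightarrow>\<^sub>E {..<n}. \<Sum>f'\<in>{..<K} \<rightarrow>\<^sub>E {..<n}. of_bool (\<forall>i\<in>L. f i = f' i)) * real n ^ card L
    \<le> real n ^ K * real n ^ K"
proof -
  let ?D = "{..<K} \<rightarrow>\<^sub>E {..<n}"
  have finD: "finite (?D \<times> ?D)" by (auto intro: finite_PiE)
  have "(\<Sum>f\<in>?D. \<Sum>f'\<in>?D. of_bool (\<forall>i\<in>L. f i = f' i))
      = (\<Sum>x\<in>?D \<times> ?D. of_bool (\<forall>i\<in>L. fst x i = snd x i) :: real)"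
    by (simp add: sum.cartesian_product split_beta)
  also have "\<dots> = real (card {(f, f') \<in> ?D \<times> ?D. \<forall>i\<in>L. f i = f' i})"
    using finD by (simp add: sum_of_bool_eq Int_def) (auto intro!: arg_cong[where f = card])
  finally show ?thesis
    using card_agreeing_pairs[OF L, of n] by (simp flip: of_nat_power of_nat_mult)
qed

lemma sum_prod_pairs:
  fixes u :: "'a \<Rightarrow> 'a \<Rightarrow> real" and v :: "'b \<Rightarrow> 'b \<Rightarrow> real"
  shows "(\<Sum>x\<in>A \<times> B. \<Sum>y\<in>A \<times> B. u (fst x) (fst y) * v (snd x) (snd y))
    = (\<Sum>a\<in>A. \<Sum>a'\<in>A. u a a') * (\<Sum>b\<in>B. \<Sum>b'\<in>B. v b b')"
proof -
  have "(\<Sum>y\<in>A \<times> B. u a (fst y) * v b (snd y)) = (\<Sum>a'\<in>A. u a a') * (\<Sum>b'\<in>B. v b b')" for a b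
    unfolding sum_product sum.cartesian_product by (simp add: split_beta)
  then have "(\<Sum>x\<in>A \<times> B. \<Sum>y\<in>A \<times> B. u (fst x) (fst y) * v (snd x) (snd y))
    = (\<Sum>x\<in>A \<times> B. (\<Sum>a'\<in>A. u (fst x) a') * (\<Sum>b'\<in>B. v (snd x) b'))" by simp
  also have "\<dots> = (\<Sum>a\<in>A. \<Sum>b\<in>B. (\<Sum>a'\<in>A. u a a') * (\<Sum>b'\<in>B. v b b'))"
    by (simp add: sum.cartesian_product split_beta)
  also have "\<dots> = (\<Sum>a\<in>A. \<Sum>a'\<in>A. u a a') * (\<Sum>b\<in>B. \<Sum>b'\<in>B. v b b')"
    by (rule sum_product[symmetric])
  finally show ?thesis .
qed

context young_diagram
begin

text \<open>Whatever part \<open>B A\<close> is chosen in each basis member, a spanning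
  configuration contains a copy of some \<open>B A\<close>, and the number of possible copies times
  their probability bounds that of spanning. Leaving \<open>B\<close> free allows a part depending
  on the weights to be inserted later.\<close>

lemma span_prob_upper:
  assumes p: "0 \<le> p" "p \<le> 1" and B: "\<And>A. A \<in> basis \<Longrightarrow> B A \<subseteq> A"
  shows "span_prob Z N M p
    \<le> (\<Sum>A\<in>basis. real N ^ card (fst ` B A) * real M ^ card (snd ` B A) * p ^ card (B A))"
proof -
  define Emb where "Emb A = {fg \<in> (fst ` B A \<rightarrow>\<^sub>E {..<N}) \<times> (snd ` B A \<rightarrow>\<^sub>E {..<M}).
    inj_on (fst fg) (fst ` B A) \<and> inj_on (snd fg) (snd ` B A)}" for A
  define F :: "pt set \<times> (nat \<Rightarrow> nat) \<times> (nat \<Rightarrow> nat) \<Rightarrow> pt set"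
    where "F = (\<lambda>(A, fg). map_prod (fst fg) (snd fg) ` B A)"
  have finB: "finite (B A)" if "A \<in> basis" for A
    using B[OF that] basisD[OF that] finite_subset by auto
  have finP: "finite ((fst ` B A \<rightarrow>\<^sub>E {..<N}) \<times> (snd ` B A \<rightarrow>\<^sub>E {..<M}))" if "A \<in> basis" for A
    using finB[OF that] by (auto intro!: finite_PiE)
  have finE: "finite (Emb A)" if "A \<in> basis" for A
    unfolding Emb_def using finP[OF that] by auto
  have cE: "real (card (Emb A)) \<le> real N ^ card (fst ` B A) * real M ^ card (snd ` B A)" if "A \<in> basis" for A
  proof -
    have "card (Emb A) \<le> card ((fst ` B A \<rightarrow>\<^sub>E {..<N}) \<times> (snd ` B A \<rightarrow>\<^sub>E {..<M}))"
      unfolding Emb_def using finP[OF that] by (intro card_mono) auto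
    also have "\<dots> = N ^ card (fst ` B A) * M ^ card (snd ` B A)"
      using finB[OF that] by (simp add: card_cartesian_product card_PiE)
    finally show ?thesis by (simp flip: of_nat_power of_nat_mult)
  qed
  have "span_prob Z N M p \<le> (\<Sum>i\<in>Sigma basis Emb. p ^ card (F i))"
    unfolding span_prob_eq
  proof (rule bernoulli_union_bound[OF finite_rect p])
    show "finite (Sigma basis Emb)" using finite_basis finE by auto
    show "F i \<subseteq> rect N M" if "i \<in> Sigma basis Emb" for i
      using that unfolding F_def Emb_def rect_eq by (force simp: PiE_def Pi_def)
    fix S assume "S \<in> {S. S \<subseteq> rect N M \<and> spans Z S}"
    then have S: "S \<subseteq> rect N M" "spans Z S" by auto
    obtain A f g where A: "A \<in> basis" "inj_on f (fst ` A)" "inj_on g (snd ` A)" "map_prod f g ` A \<subseteq> S"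
      using spans_contains_basis_copy[OF S(2)] .
    \<comment> \<open>Embeddings are recorded only by their values on the projections of the chosen
      part, which keeps the index set of the union bound finite.\<close>
    define f' where "f' = restrict f (fst ` B A)"
    define g' where "g' = restrict g (snd ` B A)"
    have BA: "B A \<subseteq> A" using B A by simp
    have im: "map_prod f' g' ` B A = map_prod f g ` B A"
      by (intro image_cong refl) (simp add: f'_def g'_def prod_eq_iff)
    have mem: "map_prod f g x \<in> rect N M" if "x \<in> B A" for x
      using that BA A(4) S(1) by blast
    have "f' \<in> fst ` B A \<rightarrow>\<^sub>E {..<N}" "g' \<in> snd ` B A \<rightarrow>\<^sub>E {..<M}"
      unfolding f'_def g'_def using mem by (auto simp: rect_def)
    moreover have "inj_on f' (fst ` B A)" "inj_on g' (snd ` B A)"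
      unfolding f'_def g'_def using A(2,3) BA by (simp_all add: inj_on_restrict_eq) (meson image_mono inj_on_subset)+
    ultimately have "(A, (f', g')) \<in> Sigma basis Emb" using A(1) by (simp add: Emb_def)
    moreover have "F (A, (f', g')) \<subseteq> S" unfolding F_def using im BA A(4) by auto
    ultimately show "S \<subseteq> rect N M \<and> (\<exists>i\<in>Sigma basis Emb. F i \<subseteq> S)" using S(1) by blast
  qed
  also have "\<dots> = (\<Sum>A\<in>basis. \<Sum>fg\<in>Emb A. p ^ card (F (A, fg)))"
    using finite_basis finE by (subst sum.Sigma) auto
  also have "\<dots> = (\<Sum>A\<in>basis. real (card (Emb A)) * p ^ card (B A))"
  proof (rule sum.cong[OF refl])
    fix A assume "A \<in> basis"
    have "card (F (A, fg)) = card (B A)" if "fg \<in> Emb A" for fg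
      unfolding F_def using that by (simp add: Emb_def card_image inj_on_map_prod_proj)
    then show "(\<Sum>fg\<in>Emb A. p ^ card (F (A, fg))) = real (card (Emb A)) * p ^ card (B A)" by simp
  qed
  also have "\<dots> \<le> (\<Sum>A\<in>basis. real N ^ card (fst ` B A) * real M ^ card (snd ` B A) * p ^ card (B A))"
    using cE p by (intro sum_mono mult_right_mono) auto
  finally show ?thesis .
qed

text \<open>
  Sending column \<open>i\<close> into the \<open>i\<close>-th block of length \<open>n\<close>, and rows likewise, makes every choice of positions
  within the blocks an injective relabelling; two choices overlap in \<open>A \<inter> L \<times> J\<close>, where \<open>L\<close> and \<open>J\<close> are
  their sets of agreement.
\<close>

lemma span_prob_lower:
  assumes A: "A \<subseteq> rect K K" "spans Z A" and nm: "0 < n" "0 < m" "K * n \<le> N" "K * m \<le> M"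
    and p: "0 < p" "p \<le> 1"
  shows "1 \<le> span_prob Z N M p * (1 + (\<Sum>(L, J) | L \<subseteq> {..<K} \<and> J \<subseteq> {..<K} \<and> A \<inter> L \<times> J \<noteq> {}.
      1 / (real n ^ card L * real m ^ card J * p ^ card (A \<inter> L \<times> J))))"
proof -
  define D where "D = (\<lambda>n::nat. {..<K} \<rightarrow>\<^sub>E {..<n})"
  define e :: "nat \<Rightarrow> (nat \<Rightarrow> nat) \<Rightarrow> nat \<Rightarrow> nat" where "e n f i = i * n + f i" for n f i
  define F where "F x = map_prod (e n (fst x)) (e m (snd x)) ` A" for x
  define T where "T = {(L, J). L \<subseteq> {..<K} \<and> J \<subseteq> {..<K} \<and> A \<inter> L \<times> J \<noteq> {}}"
  define I where "I = D n \<times> D m"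
  define a where "a = card A"
  define \<mu> where "\<mu> = real n ^ K * real m ^ K * p ^ a"
  have finA: "finite A" using A(1) finite_rect finite_subset by blast
  have fsA: "fst ` A \<subseteq> {..<K}" "snd ` A \<subseteq> {..<K}" using A(1) by (auto simp: rect_def)
  have finT: "finite T"
    by (rule finite_subset[of _ "Pow {..<K} \<times> Pow {..<K}"]) (auto simp: T_def)
  have finI: "finite I" by (auto simp: I_def D_def intro!: finite_PiE)
  have cD: "card (D n) = n ^ K" for n by (simp add: D_def card_PiE)
  have e_eq: "i = i' \<and> f i = f' i'"
    if "f \<in> D n" "f' \<in> D n" "i < K" "i' < K" "e n f i = e n f' i'" for n f f' i i'
  proof -
    have lt: "f i < n" "f' i' < n" using that by (auto simp: D_def)
    have "(i * n + f i) div n = i" "(i' * n + f' i') div n = i'"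
      using lt by simp_all
    then show ?thesis using that(5) unfolding e_def by (metis add_left_cancel)
  qed
  have e_lt: "e n f i < K * n" if "f \<in> D n" "i < K" for n f i
  proof -
    have "f i < n" using that by (auto simp: D_def)
    then have "e n f i < (i + 1) * n" by (simp add: e_def)
    also have "\<dots> \<le> K * n" using that by (intro mult_right_mono) auto
    finally show ?thesis .
  qed
  have inj: "inj_on (e n f) {..<K}" if "f \<in> D n" for n f
    using e_eq[OF that that] by (auto intro!: inj_onI)
  have injI: "inj_on (e n (fst x)) (fst ` A)" "inj_on (e m (snd x)) (snd ` A)" if "x \<in> I" for x
    using inj_on_subset[OF inj fsA(1)] inj_on_subset[OF inj fsA(2)] that by (auto simp: I_def)
  have cF: "card (F x) = a" if "x \<in> I" for x
    unfolding F_def a_def using injI[OF that] by (simp add: card_image inj_on_map_prod_proj)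
  have "(\<Sum>x\<in>I. p ^ card (F x)) = (\<Sum>x\<in>I. p ^ a)" using cF by (intro sum.cong) auto
  then have first: "(\<Sum>x\<in>I. p ^ card (F x)) = \<mu>"
    by (simp add: I_def card_cartesian_product cD \<mu>_def)
  have "(\<Sum>x\<in>I. p ^ card (F x))\<^sup>2 \<le> span_prob Z N M p * (\<Sum>x\<in>I. \<Sum>y\<in>I. p ^ card (F x \<union> F y))"
    unfolding span_prob_eq
  proof (rule bernoulli_second_moment[OF finite_rect _ p(2) finI])
    show "F x \<subseteq> rect N M" if "x \<in> I" for x
    proof -
      have "fst z < N \<and> snd z < M" if "z \<in> F x" for z
      proof -
        obtain w where w: "w \<in> A" "z = map_prod (e n (fst x)) (e m (snd x)) w"
          using \<open>z \<in> F x\<close> by (auto simp: F_def)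
        have "fst w < K" "snd w < K" using w(1) A(1) by (auto simp: rect_def)
        then have "e n (fst x) (fst w) < K * n" "e m (snd x) (snd w) < K * m"
          using e_lt \<open>x \<in> I\<close> by (auto simp: I_def)
        then show ?thesis using w(2) nm(3,4) by simp
      qed
      then show ?thesis by (auto simp: rect_def)
    qed
    show "S \<in> {S. S \<subseteq> rect N M \<and> spans Z S}" if "S \<subseteq> rect N M" "x \<in> I" "F x \<subseteq> S" for S x
    proof -
      have "spans Z (F x)" unfolding F_def using spans_inj_image[OF finA injI[OF that(2)]] A(2) by simp
      then show ?thesis using that spans_mono by simp
    qed
  qed (use p in auto)
  then have mom: "\<mu>\<^sup>2 \<le> span_prob Z N M p * (\<Sum>x\<in>I. \<Sum>y\<in>I. p ^ card (F x \<union> F y))"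
    unfolding first .
  have SP: "0 \<le> span_prob Z N M p"
    unfolding span_prob_eq using p by (intro sum_nonneg bernoulli_weight_nonneg) auto
  define ag where "ag L J x y \<longleftrightarrow> (\<forall>i\<in>L. fst x i = fst y i) \<and> (\<forall>j\<in>J. snd x j = snd y j)"
    for L J :: "nat set" and x y :: "(nat \<Rightarrow> nat) \<times> (nat \<Rightarrow> nat)"
  \<comment> \<open>The true agreement sets vary with \<open>x\<close> and \<open>y\<close>;
    bounding their term by the sum over all of \<open>T\<close> fixes the index set, so that the
    sums can be interchanged. The summand 1 covers an empty overlap.\<close>
  have pair: "p ^ card (F x \<union> F y)
      \<le> p ^ (2 * a) * (1 + (\<Sum>(L, J)\<in>T. of_bool (ag L J x y) / p ^ card (A \<inter> L \<times> J)))"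
    if xy: "x \<in> I" "y \<in> I" for x y
  proof -
    define L where "L = {i\<in>{..<K}. fst x i = fst y i}"
    define J where "J = {j\<in>{..<K}. snd x j = snd y j}"
    define c where "c = card (A \<inter> L \<times> J)"
    have "F x \<inter> F y \<subseteq> map_prod (e n (fst x)) (e m (snd x)) ` (A \<inter> L \<times> J)"
    proof
      fix z assume "z \<in> F x \<inter> F y"
      then obtain w w' where w: "w \<in> A" "z = map_prod (e n (fst x)) (e m (snd x)) w"
        "w' \<in> A" "z = map_prod (e n (fst y)) (e m (snd y)) w'" by (auto simp: F_def)
      have lt: "fst w < K" "snd w < K" "fst w' < K" "snd w' < K" using w A(1) by (auto simp: rect_def)
      have eq: "e n (fst x) (fst w) = e n (fst y) (fst w')" "e m (snd x) (snd w) = e m (snd y) (snd w')"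
        using w(2,4) by (metis fst_map_prod, metis snd_map_prod)
      have "fst w = fst w' \<and> fst x (fst w) = fst y (fst w')"
        using xy lt eq by (intro e_eq[where n = n]) (auto simp: I_def)
      moreover have "snd w = snd w' \<and> snd x (snd w) = snd y (snd w')"
        using xy lt eq by (intro e_eq[where n = m]) (auto simp: I_def)
      ultimately have "w \<in> A \<inter> L \<times> J" using w(1) lt by (auto simp: L_def J_def mem_Times_iff)
      then show "z \<in> map_prod (e n (fst x)) (e m (snd x)) ` (A \<inter> L \<times> J)" using w(2) by blast
    qed
    then have "card (F x \<inter> F y) \<le> c"
      unfolding c_def using finA by (meson card_image_le card_mono finite_Int finite_imageI order_trans)
    moreover have "card (F x) + card (F y) = card (F x \<union> F y) + card (F x \<inter> F y)"
      using finA by (intro card_Un_Int) (auto simp: F_def)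
    ultimately have "2 * a \<le> card (F x \<union> F y) + c" using cF xy by simp
    then have "p ^ (card (F x \<union> F y) + c) \<le> p ^ (2 * a)" using p by (intro power_decreasing) auto
    then have "p ^ card (F x \<union> F y) \<le> p ^ (2 * a) * (1 / p ^ c)"
      using p by (simp add: power_add field_simps)
    also have "\<dots> \<le> p ^ (2 * a) * (1 + (\<Sum>(L, J)\<in>T. of_bool (ag L J x y) / p ^ card (A \<inter> L \<times> J)))"
    proof (rule mult_left_mono)
      let ?g = "\<lambda>LJ. of_bool (ag (fst LJ) (snd LJ) x y) / p ^ card (A \<inter> fst LJ \<times> snd LJ)"
      have nn: "0 \<le> ?g LJ" for LJ using p by simp
      show "1 / p ^ c \<le> 1 + (\<Sum>(L, J)\<in>T. of_bool (ag L J x y) / p ^ card (A \<inter> L \<times> J))"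
      proof (cases "A \<inter> L \<times> J = {}")
        case True
        then show ?thesis using sum_nonneg[of T ?g] nn by (simp add: c_def split_beta)
      next
        case False
        then have "(L, J) \<in> T" by (auto simp: T_def L_def J_def)
        then have "?g (L, J) \<le> sum ?g T" using nn finT by (intro member_le_sum) auto
        moreover have "?g (L, J) = 1 / p ^ c" by (simp add: c_def ag_def L_def J_def)
        ultimately show ?thesis by (simp add: split_beta)
      qed
    qed (use p in simp)
    finally show ?thesis .
  qed
  \<comment> \<open>\<open>ag\<close> asks for agreement at least on \<open>L\<close> and
    \<open>J\<close>, with no condition elsewhere, so the count factors into columns and
    rows.\<close>
  have count: "(\<Sum>x\<in>I. \<Sum>y\<in>I. of_bool (ag L J x y)) \<le>
      (real n ^ K * real m ^ K)\<^sup>2 / (real n ^ card L * real m ^ card J)"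
    if "(L, J) \<in> T" for L J
  proof -
    define s where "s n L = (\<Sum>f\<in>D n. \<Sum>f'\<in>D n. of_bool (\<forall>i\<in>L. f i = f' i) :: real)" for n L
    have s0: "0 \<le> s n L" for n L unfolding s_def by (intro sum_nonneg) auto
    have "s n L * real n ^ card L \<le> real n ^ K * real n ^ K" if "L \<subseteq> {..<K}" for n L
      unfolding s_def D_def using sum_agreeing_pairs[OF that] .
    then have s1: "s n L \<le> (real n ^ K)\<^sup>2 / real n ^ card L" if "L \<subseteq> {..<K}" "0 < n" for n L
      using that by (simp add: pos_le_divide_eq power2_eq_square)
    have "(\<Sum>x\<in>I. \<Sum>y\<in>I. of_bool (ag L J x y)) = s n L * s m J"
      unfolding I_def s_def ag_def of_bool_conj by (rule sum_prod_pairs)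
    also have "\<dots> \<le> ((real n ^ K)\<^sup>2 / real n ^ card L) * ((real m ^ K)\<^sup>2 / real m ^ card J)"
      using that s0 s1 nm by (intro mult_mono) (auto simp: T_def)
    also have "\<dots> = (real n ^ K * real m ^ K)\<^sup>2 / (real n ^ card L * real m ^ card J)"
      by (simp add: power_mult_distrib)
    finally show ?thesis .
  qed
  have count_le: "(\<Sum>x\<in>I. \<Sum>y\<in>I. of_bool (ag L J x y)) / p ^ card (A \<inter> L \<times> J)
      \<le> ((real n ^ K * real m ^ K)\<^sup>2 / (real n ^ card L * real m ^ card J)) / p ^ card (A \<inter> L \<times> J)"
    if "(L, J) \<in> T" for L J
    using count[OF that] by (rule divide_right_mono) (use p in simp)
  let ?R = "\<Sum>(L, J)\<in>T. 1 / (real n ^ card L * real m ^ card J * p ^ card (A \<inter> L \<times> J))"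
  have "(\<Sum>x\<in>I. \<Sum>y\<in>I. p ^ card (F x \<union> F y))
      \<le> (\<Sum>x\<in>I. \<Sum>y\<in>I. p ^ (2 * a) * (1 + (\<Sum>(L, J)\<in>T. of_bool (ag L J x y) / p ^ card (A \<inter> L \<times> J))))"
    using pair by (intro sum_mono)
  also have "\<dots> = p ^ (2 * a) * ((real n ^ K * real m ^ K)\<^sup>2
      + (\<Sum>(L, J)\<in>T. (\<Sum>x\<in>I. \<Sum>y\<in>I. of_bool (ag L J x y)) / p ^ card (A \<inter> L \<times> J)))"
  proof -
    have "(\<Sum>x\<in>I. \<Sum>y\<in>I. 1 + (\<Sum>(L, J)\<in>T. of_bool (ag L J x y) / p ^ card (A \<inter> L \<times> J)))
      = real (card I) ^ 2 + (\<Sum>x\<in>I. \<Sum>y\<in>I. \<Sum>(L, J)\<in>T. of_bool (ag L J x y) / p ^ card (A \<inter> L \<times> J))"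
      by (simp add: sum.distrib power2_eq_square)
    also have "(\<Sum>x\<in>I. \<Sum>y\<in>I. \<Sum>(L, J)\<in>T. of_bool (ag L J x y) / p ^ card (A \<inter> L \<times> J))
      = (\<Sum>x\<in>I. \<Sum>(L, J)\<in>T. \<Sum>y\<in>I. of_bool (ag L J x y) / p ^ card (A \<inter> L \<times> J))"
      unfolding split_beta by (rule sum.cong[OF refl], rule sum.swap)
    also have "\<dots> = (\<Sum>(L, J)\<in>T. \<Sum>x\<in>I. \<Sum>y\<in>I. of_bool (ag L J x y) / p ^ card (A \<inter> L \<times> J))"
      unfolding split_beta by (rule sum.swap)
    finally show ?thesis
      by (simp add: I_def card_cartesian_product cD sum_divide_distrib flip: sum_distrib_left)
  qed
  also have "\<dots> \<le> p ^ (2 * a) * ((real n ^ K * real m ^ K)\<^sup>2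
      + (\<Sum>(L, J)\<in>T. ((real n ^ K * real m ^ K)\<^sup>2 / (real n ^ card L * real m ^ card J)) / p ^ card (A \<inter> L \<times> J)))"
    using count_le p by (intro mult_left_mono add_left_mono sum_mono) (auto simp del: divide_divide_eq_left)
  also have "\<dots> = \<mu>\<^sup>2 * (1 + ?R)"
    by (simp add: \<mu>_def power_mult_distrib algebra_simps sum_distrib_left split_beta power_mult[symmetric])
  finally have "(\<Sum>x\<in>I. \<Sum>y\<in>I. p ^ card (F x \<union> F y)) \<le> \<mu>\<^sup>2 * (1 + ?R)" .
  from order_trans[OF mom mult_left_mono[OF this SP]]
  have "\<mu>\<^sup>2 * 1 \<le> \<mu>\<^sup>2 * (span_prob Z N M p * (1 + ?R))" by (simp only: mult.left_commute mult_1_right)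
  moreover have "0 < \<mu>\<^sup>2" using nm p by (simp add: \<mu>_def)
  ultimately have "1 \<le> span_prob Z N M p * (1 + ?R)" by (rule mult_left_le_imp_le)
  then show ?thesis by (simp add: T_def)
qed

end

section \<open>The large deviation rate\<close>

lemma eventually_at_right_0_less: "0 < (c::real) \<Longrightarrow> eventually (\<lambda>p. 0 < p \<and> p < c) (at_right 0)"
  unfolding eventually_at_right_field by auto

lemma neg_ln_at_top: "filterlim (\<lambda>p::real. - ln p) at_top (at_right 0)"
  using ln_at_0 by (simp add: filterlim_uminus_at_bot)

lemma tendsto_const_over_neg_ln: "((\<lambda>p::real. c / (- ln p)) \<longlongrightarrow> 0) (at_right 0)"
  by (rule tendsto_divide_0[OF tendsto_const filterlim_at_top_imp_at_infinity[OF neg_ln_at_top]])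

lemma powr_small: "0 < d \<Longrightarrow> ((\<lambda>p::real. p powr d) \<longlongrightarrow> 0) (at_right 0)"
  by (rule tendsto_eq_rhs[OF tendsto_powr'[OF tendsto_ident_at tendsto_const]])
    (auto simp: eventually_at_filter)

text \<open>Division by the negative ln p reverses inequalities: an upper bound on a probability is
  a lower bound on its exponent.\<close>

lemma ln_ratio_iff_powr:
  fixes p x s :: real
  assumes "0 < p" "p < 1" "0 < x"
  shows "s < ln x / ln p \<longleftrightarrow> x < p powr s" "ln x / ln p < s \<longleftrightarrow> p powr s < x"
    "s \<le> ln x / ln p \<longleftrightarrow> x \<le> p powr s" "ln x / ln p \<le> s \<longleftrightarrow> p powr s \<le> x"
proof -
  have l: "ln p < 0" using assms by simp
  have "ln (p powr s) = s * ln p" "0 < p powr s" using assms by (simp_all add: ln_powr)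
  then show "s < ln x / ln p \<longleftrightarrow> x < p powr s" "ln x / ln p < s \<longleftrightarrow> p powr s < x"
    "s \<le> ln x / ln p \<longleftrightarrow> x \<le> p powr s" "ln x / ln p \<le> s \<longleftrightarrow> p powr s \<le> x"
    using l assms(3) ln_less_cancel_iff[of x "p powr s"] ln_less_cancel_iff[of "p powr s" x]
      ln_le_cancel_iff[of x "p powr s"] ln_le_cancel_iff[of "p powr s" x]
    by (simp_all add: neg_less_divide_eq neg_divide_less_eq neg_le_divide_eq neg_divide_le_eq)
qed

text \<open>For x at least \<open>K\<close>, the block length x div K lies between x / (2 K) and x,
  and the constant vanishes after division by - ln p.\<close>

lemma log_scale_div:
  fixes N :: "real \<Rightarrow> nat"
  assumes N: "filterlim N at_top (at_right 0)"
    and lim: "((\<lambda>p. ln (real (N p)) / (- ln p)) \<longlongrightarrow> \<alpha>) (at_right 0)" and K: "0 < K"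
  shows "filterlim (\<lambda>p. N p div K) at_top (at_right 0)"
    and "((\<lambda>p. ln (real (N p div K)) / (- ln p)) \<longlongrightarrow> \<alpha>) (at_right 0)"
proof -
  show "filterlim (\<lambda>p. N p div K) at_top (at_right 0)"
    unfolding filterlim_at_top
  proof
    fix c
    have "eventually (\<lambda>p. c * K \<le> N p) (at_right 0)" using N by (simp add: filterlim_at_top)
    then show "eventually (\<lambda>p. c \<le> N p div K) (at_right 0)"
      by eventually_elim (use K in \<open>simp add: less_eq_div_iff_mult_less_eq\<close>)
  qed
  have ev: "eventually (\<lambda>p. K \<le> N p) (at_right 0)" using N by (simp add: filterlim_at_top)
  have ev1: "eventually (\<lambda>p::real. 0 < p \<and> p < 1) (at_right 0)" by (rule eventually_at_right_0_less) simp
  have lnb: "ln (real x) - ln (2 * real K) \<le> ln (real (x div K)) \<and> ln (real (x div K)) \<le> ln (real x)"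
    if "K \<le> x" for x
  proof -
    have 1: "1 \<le> x div K" using that K by (simp add: less_eq_div_iff_mult_less_eq)
    have "x < K * (x div K + 1)"
      using mult_div_mod_eq[of K x] mod_less_divisor[OF K, of x]
      by (simp only: distrib_left mult_1_right)
    also have "\<dots> \<le> K * (2 * (x div K))" using 1 by (intro mult_left_mono) auto
    finally have "real x \<le> real (K * (2 * (x div K)))" by (intro of_nat_mono) simp
    then have "real x \<le> 2 * real K * real (x div K)" by simp
    then have "ln (real x) \<le> ln (2 * real K * real (x div K))" using that K 1 by (subst ln_le_cancel_iff) auto
    also have "\<dots> = ln (2 * real K) + ln (real (x div K))" using K 1 by (subst ln_mult) auto
    finally show ?thesis using 1 that K by (auto simp: div_le_dividend)
  qed
  have "((\<lambda>p. ln (real (N p)) / (- ln p) - ln (2 * real K) / (- ln p)) \<longlongrightarrow> \<alpha> - 0) (at_right 0)"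
    using lim tendsto_const_over_neg_ln by (rule tendsto_diff)
  then have low: "((\<lambda>p. (ln (real (N p)) - ln (2 * real K)) / (- ln p)) \<longlongrightarrow> \<alpha>) (at_right 0)"
    by (simp only: diff_divide_distrib diff_0_right)
  show "((\<lambda>p. ln (real (N p div K)) / (- ln p)) \<longlongrightarrow> \<alpha>) (at_right 0)"
  proof (rule tendsto_sandwich[OF _ _ low lim])
    show "\<forall>\<^sub>F p in at_right 0. (ln (real (N p)) - ln (2 * real K)) / (- ln p) \<le> ln (real (N p div K)) / (- ln p)"
      using ev ev1 by eventually_elim (intro divide_right_mono, use lnb in auto)
    show "\<forall>\<^sub>F p in at_right 0. ln (real (N p div K)) / (- ln p) \<le> ln (real (N p)) / (- ln p)"
      using ev ev1 by eventually_elim (intro divide_right_mono, use lnb in auto)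
  qed
qed

lemma admissible_div:
  assumes "admissible \<alpha> \<beta> N M" "0 < K"
  shows "admissible \<alpha> \<beta> (\<lambda>p. N p div K) (\<lambda>p. M p div K)"
  using assms log_scale_div[of N \<alpha> K] log_scale_div[of M \<beta> K] unfolding admissible_def by blast

lemma admissible_pos:
  assumes "admissible \<alpha> \<beta> N M"
  shows "eventually (\<lambda>p. 0 < N p \<and> 0 < M p) (at_right 0)"
proof -
  have "eventually (\<lambda>p. 1 \<le> N p) (at_right 0)" "eventually (\<lambda>p. 1 \<le> M p) (at_right 0)"
    using assms unfolding admissible_def filterlim_at_top by blast+
  then show ?thesis by eventually_elim simp
qed

lemma log_monomial_tendsto:
  assumes adm: "admissible \<alpha> \<beta> N M"
  shows "((\<lambda>p. ln (real (N p) ^ a * real (M p) ^ b * p ^ c) / ln p)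
    \<longlongrightarrow> real c - \<alpha> * real a - \<beta> * real b) (at_right 0)"
proof -
  have "((\<lambda>p. real c - (ln (real (N p)) / (- ln p)) * real a - (ln (real (M p)) / (- ln p)) * real b)
      \<longlongrightarrow> real c - \<alpha> * real a - \<beta> * real b) (at_right 0)"
    using adm unfolding admissible_def by (intro tendsto_intros) auto
  then show ?thesis
  proof (rule Lim_transform_eventually)
    have "eventually (\<lambda>p::real. 0 < p \<and> p < 1) (at_right 0)" by (rule eventually_at_right_0_less) simp
    then show "\<forall>\<^sub>F p in at_right 0. real c - (ln (real (N p)) / (- ln p)) * real a - (ln (real (M p)) / (- ln p)) * real b
        = ln (real (N p) ^ a * real (M p) ^ b * p ^ c) / ln p"
      using admissible_pos[OF adm]
    proof eventually_elim
      case (elim p)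
      then have "ln (real (N p) ^ a * real (M p) ^ b * p ^ c) = a * ln (real (N p)) + b * ln (real (M p)) + c * ln p"
        by (simp add: ln_mult ln_realpow)
      moreover have "ln p \<noteq> 0" using elim by simp
      ultimately show ?case by (simp add: field_simps)
    qed
  qed
qed

text \<open>Without an admissible scaling, \<open>rate_limit\<close> would hold for every value and
  \<open>rate\<close> would not be determined. The factor - ln p in \<open>x\<close> forces
  \<open>N\<close> to infinity even for \<alpha> = 0, and contributes only ln (- ln p) / (- ln p),
  which tends to 0.\<close>

lemma admissible_scale_exists:
  assumes "0 \<le> \<alpha>"
  shows "\<exists>N :: real \<Rightarrow> nat. filterlim N at_top (at_right 0)
    \<and> ((\<lambda>p. ln (real (N p)) / (- ln p)) \<longlongrightarrow> \<alpha>) (at_right 0)"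
proof -
  define x where "x p = (- ln p) * p powr (- \<alpha>)" for p :: real
  define N where "N p = nat \<lceil>x p\<rceil>" for p
  have evl: "eventually (\<lambda>p::real. 1 \<le> - ln p) (at_right 0)"
    using neg_ln_at_top unfolding filterlim_at_top by blast
  have ev1: "eventually (\<lambda>p::real. 0 < p \<and> p < 1) (at_right 0)" by (rule eventually_at_right_0_less) simp
  have x_ge: "- ln p \<le> x p" if "0 < p" "p < 1" for p
  proof -
    have "1 \<le> p powr (- \<alpha>)" using that assms by (simp add: powr_minus powr_le1 one_le_inverse_iff)
    then have "(- ln p) * 1 \<le> (- ln p) * p powr (- \<alpha>)" using that by (intro mult_left_mono) auto
    then show ?thesis by (simp add: x_def)
  qed
  have "filterlim N at_top (at_right 0)"
    unfolding filterlim_at_top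
  proof
    fix c
    have "eventually (\<lambda>p::real. real c \<le> - ln p) (at_right 0)"
      using neg_ln_at_top unfolding filterlim_at_top by blast
    then show "eventually (\<lambda>p. c \<le> N p) (at_right 0)"
      using ev1
    proof eventually_elim
      case (elim p)
      then have "real c \<le> x p" using x_ge[of p] by linarith
      then show ?case unfolding N_def by linarith
    qed
  qed
  moreover have "((\<lambda>p. ln (real (N p)) / (- ln p)) \<longlongrightarrow> \<alpha>) (at_right 0)"
  proof (rule tendsto_sandwich)
    have "((\<lambda>p::real. ln (- ln p) / (- ln p)) \<longlongrightarrow> 0) (at_right 0)"
      using filterlim_compose[OF ln_x_over_x_tendsto_0 neg_ln_at_top] .
    from tendsto_add[OF this tendsto_const[of \<alpha>]]
    have 1: "((\<lambda>p. ln (- ln p) / (- ln p) + \<alpha>) \<longlongrightarrow> \<alpha>) (at_right 0)" by simp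
    then show "((\<lambda>p. ln (- ln p) / (- ln p) + \<alpha>) \<longlongrightarrow> \<alpha>) (at_right 0)" .
    from tendsto_add[OF tendsto_const_over_neg_ln[of "ln 2"] 1]
    show "((\<lambda>p. ln 2 / (- ln p) + (ln (- ln p) / (- ln p) + \<alpha>)) \<longlongrightarrow> \<alpha>) (at_right 0)" by simp
    have main: "eventually (\<lambda>p. ln (- ln p) / (- ln p) + \<alpha> \<le> ln (real (N p)) / (- ln p) \<and>
        ln (real (N p)) / (- ln p) \<le> ln 2 / (- ln p) + (ln (- ln p) / (- ln p) + \<alpha>)) (at_right 0)"
      using evl ev1
    proof eventually_elim
      case (elim p)
      have cancel: "\<alpha> * (- ln p) / (- ln p) = \<alpha>" using elim by auto
      have x1: "1 \<le> x p" using x_ge[of p] elim by linarith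
      have lx: "ln (x p) = ln (- ln p) + \<alpha> * (- ln p)"
        unfolding x_def using elim by (subst ln_mult) (auto simp: ln_powr)
      have "x p \<le> real (N p)" "real (N p) \<le> 2 * x p" unfolding N_def using x1 by linarith+
      then have "ln (x p) \<le> ln (real (N p))" "ln (real (N p)) \<le> ln (2 * x p)"
        using x1 by (simp_all add: ln_le_cancel_iff)
      moreover have "ln (2 * x p) = ln 2 + ln (x p)" using x1 by (subst ln_mult) auto
      ultimately have le: "(ln (- ln p) + \<alpha> * (- ln p)) / (- ln p) \<le> ln (real (N p)) / (- ln p)"
        "ln (real (N p)) / (- ln p) \<le> (ln 2 + (ln (- ln p) + \<alpha> * (- ln p))) / (- ln p)"
        using elim lx by (intro divide_right_mono; linarith)+
      have eq: "(ln (- ln p) + \<alpha> * (- ln p)) / (- ln p) = ln (- ln p) / (- ln p) + \<alpha>"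
        "(ln 2 + (ln (- ln p) + \<alpha> * (- ln p))) / (- ln p) = ln 2 / (- ln p) + (ln (- ln p) / (- ln p) + \<alpha>)"
        by (simp_all only: add_divide_distrib cancel)
      show ?case using le unfolding eq by (rule conjI)
    qed
    show "eventually (\<lambda>p. ln (- ln p) / (- ln p) + \<alpha> \<le> ln (real (N p)) / (- ln p)) (at_right 0)"
      "eventually (\<lambda>p. ln (real (N p)) / (- ln p) \<le> ln 2 / (- ln p) + (ln (- ln p) / (- ln p) + \<alpha>)) (at_right 0)"
      using main by (auto elim: eventually_mono)
  qed
  ultimately show ?thesis by blast
qed

lemma admissible_exists:
  assumes "0 \<le> \<alpha>" "0 \<le> \<beta>"
  shows "\<exists>N M. admissible \<alpha> \<beta> N M"
  using admissible_scale_exists[OF assms(1)] admissible_scale_exists[OF assms(2)]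
  unfolding admissible_def by blast

lemma span_prob_nonneg: "\<lbrakk>0 \<le> p; p \<le> 1\<rbrakk> \<Longrightarrow> 0 \<le> span_prob Z N M p"
  unfolding span_prob_eq by (intro sum_nonneg bernoulli_weight_nonneg) auto

lemma span_prob_le_1:
  assumes "0 \<le> p" "p \<le> 1"
  shows "span_prob Z N M p \<le> 1"
proof -
  have "span_prob Z N M p \<le> sum (bernoulli_weight (rect N M) p) {S. {} \<subseteq> S \<and> S \<subseteq> rect N M}"
    unfolding span_prob_eq using finite_rect[of N M] assms
    by (intro sum_mono2) (auto intro: bernoulli_weight_nonneg)
  also have "\<dots> = 1" using bernoulli_superset_prob[OF finite_rect, of "{}" N M p] by simp
  finally show ?thesis .
qed

context young_diagram
begin

lemma empty_not_spans: "\<not> spans Z {}"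
proof -
  have "(NG Z ^^ t) {} = {}" for t
    by (induction t) (use zero_mem in \<open>auto simp: NG_def row_pts_def col_pts_def\<close>)
  then show ?thesis by (simp add: spans_def)
qed

lemma spanning_side_pos: "\<lbrakk>A \<subseteq> rect K K; spans Z A\<rbrakk> \<Longrightarrow> 0 < K"
  using empty_not_spans by (cases K) (auto simp: rect_def)

lemma span_prob_lower_eventually:
  assumes adm: "admissible \<alpha> \<beta> N M" and A: "A \<subseteq> rect K K" "spans Z A"
  shows "eventually (\<lambda>p. 1 \<le> span_prob Z (N p) (M p) p *
    (1 + (\<Sum>(L, J) | L \<subseteq> {..<K} \<and> J \<subseteq> {..<K} \<and> A \<inter> L \<times> J \<noteq> {}.
      1 / (real (N p div K) ^ card L * real (M p div K) ^ card J * p ^ card (A \<inter> L \<times> J))))) (at_right 0)"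
proof -
  have K: "0 < K" using spanning_side_pos[OF A] .
  have "eventually (\<lambda>p::real. 0 < p \<and> p < 1) (at_right 0)" by (rule eventually_at_right_0_less) simp
  then show ?thesis using admissible_pos[OF admissible_div[OF adm K]]
    by eventually_elim (rule span_prob_lower[OF A], use K in auto)
qed

theorem rate_limit_rate_fun:
  assumes "0 \<le> \<alpha>" "0 \<le> \<beta>"
  shows "rate_limit Z \<alpha> \<beta> (rate_fun \<alpha> \<beta>)"
  unfolding rate_limit_def
proof (intro allI impI)
  fix N M assume adm: "admissible \<alpha> \<beta> N M"
  define P where "P p = span_prob Z (N p) (M p) p" for p
  define r where "r = rate_fun \<alpha> \<beta>"
  have r0: "0 \<le> r" by (simp add: r_def rate_fun_nonneg)
  have ev1: "eventually (\<lambda>p::real. 0 < p \<and> p < 1) (at_right 0)" by (rule eventually_at_right_0_less) simp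
  have upper: "eventually (\<lambda>p. P p \<le> p powr (r - \<epsilon>)) (at_right 0)" if \<epsilon>: "0 < \<epsilon>" for \<epsilon>
  proof -
    \<comment> \<open>The part attaining \<open>rho\<close> is the rarest one on the logarithmic
      scale; with it, each term of the union bound has limiting exponent at least
      \<open>r\<close>.\<close>
    have "\<forall>A\<in>basis. \<exists>B. B \<subseteq> A \<and> rho \<alpha> \<beta> A = excess \<alpha> \<beta> B"
    proof
      fix A assume "A \<in> basis"
      then have "finite A" using basisD by simp
      then show "\<exists>B. B \<subseteq> A \<and> rho \<alpha> \<beta> A = excess \<alpha> \<beta> B"
        by (rule rho_attained[of A \<alpha> \<beta>]) auto
    qed
    from bchoice[OF this] obtain B where
      B: "\<And>A. A \<in> basis \<Longrightarrow> B A \<subseteq> A \<and> rho \<alpha> \<beta> A = excess \<alpha> \<beta> (B A)" by auto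
    define x where "x A p = real (N p) ^ card (fst ` B A) * real (M p) ^ card (snd ` B A) * p ^ card (B A)" for A p
    have "eventually (\<lambda>p. x A p \<le> p powr (r - \<epsilon> / 2)) (at_right 0)" if A: "A \<in> basis" for A
    proof -
      have "r \<le> excess \<alpha> \<beta> (B A)"
        using B[OF A] rate_fun_le_rho[of A \<alpha> \<beta>] basisD[OF A] by (simp add: r_def)
      then have "r - \<epsilon> / 2 < real (card (B A)) - \<alpha> * real (card (fst ` B A)) - \<beta> * real (card (snd ` B A))"
        using \<epsilon> by (simp add: excess_def)
      from order_tendstoD(1)[OF log_monomial_tendsto[OF adm] this]
      show ?thesis using ev1 admissible_pos[OF adm]
      proof eventually_elim
        case (elim p)
        moreover from elim have "0 < x A p" by (simp add: x_def)
        ultimately show ?case using ln_ratio_iff_powr(1)[of p "x A p" "r - \<epsilon> / 2"] by (simp add: x_def)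
      qed
    qed
    then have ev: "eventually (\<lambda>p. \<forall>A\<in>basis. x A p \<le> p powr (r - \<epsilon> / 2)) (at_right 0)"
      using finite_basis by (simp add: eventually_ball_finite)
    \<comment> \<open>One half of \<open>\<epsilon>\<close> pays for the convergence of the
      exponents, the other for the number of terms.\<close>
    have "((\<lambda>p. real (card basis) * p powr (\<epsilon> / 2)) \<longlongrightarrow> real (card basis) * 0) (at_right 0)"
      using \<epsilon> by (intro tendsto_intros powr_small) auto
    then have "eventually (\<lambda>p. real (card basis) * p powr (\<epsilon> / 2) < 1) (at_right 0)"
      by (rule order_tendstoD) simp
    then show ?thesis using ev ev1
    proof eventually_elim
      case (elim p)
      have "P p \<le> (\<Sum>A\<in>basis. x A p)"
        unfolding P_def x_def using elim B by (intro span_prob_upper) auto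
      also have "\<dots> \<le> real (card basis) * p powr (r - \<epsilon> / 2)"
        using elim sum_bounded_above[of basis "\<lambda>A. x A p"] by simp
      also have "\<dots> = (real (card basis) * p powr (\<epsilon> / 2)) * p powr (r - \<epsilon>)"
        by (simp add: mult.assoc flip: powr_add)
      also have "\<dots> \<le> 1 * p powr (r - \<epsilon>)" using elim by (intro mult_right_mono) auto
      finally show ?case by simp
    qed
  qed
  have lower: "eventually (\<lambda>p. p powr (r + \<epsilon>) \<le> P p) (at_right 0)" if \<epsilon>: "0 < \<epsilon>" for \<epsilon>
  proof -
    define K where "K = witness_size"
    obtain A where A: "A \<in> basis" "r = rho \<alpha> \<beta> A"
      using rate_fun_attained[of \<alpha> \<beta>] unfolding r_def .
    have AK: "A \<subseteq> rect K K" "spans Z A" using A by (auto simp: basis_def K_def)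
    have finA: "finite A" using AK finite_rect finite_subset by blast
    define T where "T = {(L, J). L \<subseteq> {..<K} \<and> J \<subseteq> {..<K} \<and> A \<inter> L \<times> J \<noteq> {}}"
    have finT: "finite T"
      by (rule finite_subset[of _ "Pow {..<K} \<times> Pow {..<K}"]) (auto simp: T_def)
    have K: "0 < K" using spanning_side_pos[OF AK] .
    define y where "y LJ p = real (N p div K) ^ card (fst LJ) * real (M p div K) ^ card (snd LJ) * p ^ card (A \<inter> fst LJ \<times> snd LJ)"
      for LJ p
    have "eventually (\<lambda>p. 1 / y LJ p \<le> p powr (- (r + \<epsilon> / 2))) (at_right 0)" if LJ: "LJ \<in> T" for LJ
    proof -
      define B where "B = A \<inter> fst LJ \<times> snd LJ"
      have "finite (fst LJ)" "finite (snd LJ)"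
        using LJ finite_subset[OF _ finite_lessThan] by (auto simp: T_def)
      then have "card (fst ` B) \<le> card (fst LJ)" "card (snd ` B) \<le> card (snd LJ)"
        by (auto intro!: card_mono simp: B_def)
      \<comment> \<open>\<open>L\<close> and \<open>J\<close> may exceed the projections of
        \<open>B\<close>; as the weights are nonnegative, this can only lower the exponent. So every
        exponent is at most the excess of a part of \<open>A\<close>, hence at most
        \<open>r\<close>.\<close>
      then have "real (card B) - \<alpha> * real (card (fst LJ)) - \<beta> * real (card (snd LJ)) \<le> excess \<alpha> \<beta> B"
        using assms unfolding excess_def by (smt (verit) mult_left_mono of_nat_le_iff)
      also have "\<dots> \<le> r" using A excess_le_rho[OF finA, of B] by (simp add: B_def)
      also have "r < r + \<epsilon> / 2" using \<epsilon> by simp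
      finally have "real (card B) - \<alpha> * real (card (fst LJ)) - \<beta> * real (card (snd LJ)) < r + \<epsilon> / 2" .
      from order_tendstoD(2)[OF log_monomial_tendsto[OF admissible_div[OF adm K]] this]
      show ?thesis using ev1 admissible_pos[OF admissible_div[OF adm K]]
      proof eventually_elim
        case (elim p)
        have y0: "0 < y LJ p" using elim by (simp add: y_def)
        then have "p powr (r + \<epsilon> / 2) < y LJ p"
          using elim ln_ratio_iff_powr(2)[of p "y LJ p" "r + \<epsilon> / 2"] by (simp add: y_def B_def)
        then have "inverse (y LJ p) \<le> inverse (p powr (r + \<epsilon> / 2))"
          using elim by (intro le_imp_inverse_le) auto
        then show ?case by (simp only: powr_minus inverse_eq_divide)
      qed
    qed
    then have ev: "eventually (\<lambda>p. \<forall>LJ\<in>T. 1 / y LJ p \<le> p powr (- (r + \<epsilon> / 2))) (at_right 0)"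
      using finT by (simp add: eventually_ball_finite)
    have "((\<lambda>p. (1 + real (card T)) * p powr (\<epsilon> / 2)) \<longlongrightarrow> (1 + real (card T)) * 0) (at_right 0)"
      using \<epsilon> by (intro tendsto_intros powr_small) auto
    then have "eventually (\<lambda>p. (1 + real (card T)) * p powr (\<epsilon> / 2) < 1) (at_right 0)"
      by (rule order_tendstoD) simp
    then show ?thesis using ev ev1 span_prob_lower_eventually[OF adm AK]
    proof eventually_elim
      case (elim p)
      have P0: "0 \<le> P p" unfolding P_def using elim by (intro span_prob_nonneg) auto
      have split: "p powr (- (r + \<epsilon> / 2)) = p powr (\<epsilon> / 2) * p powr (- (r + \<epsilon>))"
        unfolding powr_add[symmetric] by (rule arg_cong[where f = "(powr) p"]) (simp add: field_simps)
      \<comment> \<open>Because \<open>r\<close> is nonnegative, the leading 1 of the second moment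
        bound is itself at most this power and is absorbed like one more overlap term.\<close>
      have one: "1 \<le> p powr (- (r + \<epsilon> / 2))"
        unfolding powr_minus using elim r0 \<epsilon> by (intro one_le_inverse powr_le1) auto
      have "1 \<le> P p * (1 + (\<Sum>LJ\<in>T. 1 / y LJ p))"
        using elim by (simp add: P_def T_def y_def split_beta)
      also have "\<dots> \<le> P p * (p powr (- (r + \<epsilon> / 2)) + real (card T) * p powr (- (r + \<epsilon> / 2)))"
        using P0 one elim sum_bounded_above[of T "\<lambda>LJ. 1 / y LJ p"] by (intro mult_left_mono add_mono) auto
      also have "\<dots> = P p * ((1 + real (card T)) * p powr (\<epsilon> / 2)) * p powr (- (r + \<epsilon>))"
        unfolding split by (simp add: algebra_simps)
      also have "\<dots> \<le> P p * 1 * p powr (- (r + \<epsilon>))"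
        using P0 elim by (intro mult_right_mono mult_left_mono) auto
      finally have "1 \<le> P p * p powr (- (r + \<epsilon>))" by simp
      then have "p powr (r + \<epsilon>) * 1 \<le> p powr (r + \<epsilon>) * (P p * p powr (- (r + \<epsilon>)))"
        by (intro mult_left_mono) auto
      also have "\<dots> = P p * (p powr (r + \<epsilon>) * p powr (- (r + \<epsilon>)))" by (simp only: mult_ac)
      also have "p powr (r + \<epsilon>) * p powr (- (r + \<epsilon>)) = 1" using elim by (simp flip: powr_add)
      finally show ?case by simp
    qed
  qed
  show "((\<lambda>p. ln (span_prob Z (N p) (M p) p) / ln p) \<longlongrightarrow> rate_fun \<alpha> \<beta>) (at_right 0)"
    unfolding r_def[symmetric] P_def[symmetric]
  proof (rule tendstoI)
    fix e :: real assume "0 < e"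
    then have e: "0 < e / 2" by simp
    show "eventually (\<lambda>p. dist (ln (P p) / ln p) r < e) (at_right 0)"
      using upper[OF e] lower[OF e] ev1
    proof eventually_elim
      case (elim p)
      then have "0 < P p" by (smt (verit) powr_gt_zero)
      then have "r - e / 2 \<le> ln (P p) / ln p" "ln (P p) / ln p \<le> r + e / 2"
        using elim ln_ratio_iff_powr(3,4)[of p "P p"] by auto
      then show ?case using \<open>0 < e\<close> by (simp add: dist_real_def abs_less_iff)
    qed
  qed
qed

theorem rate_eq:
  assumes "0 \<le> \<alpha>" "0 \<le> \<beta>"
  shows "rate Z \<alpha> \<beta> = rate_fun \<alpha> \<beta>"
  unfolding rate_def
proof (rule the_equality)
  show lim: "rate_limit Z \<alpha> \<beta> (rate_fun \<alpha> \<beta>)" by (rule rate_limit_rate_fun[OF assms])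
  fix L assume L: "rate_limit Z \<alpha> \<beta> L"
  obtain N M where "admissible \<alpha> \<beta> N M" using admissible_exists[OF assms] by blast
  then show "L = rate_fun \<alpha> \<beta>"
    using L lim unfolding rate_limit_def by (meson tendsto_unique trivial_limit_at_right_real)
qed

text \<open>Negative excess of every nonempty part makes each overlap term tend to 0, so the second
  moment bound becomes 1 \<le> P (1 + o(1)). Vanishing of \<open>rho\<close> alone would not give
  this, since the overlap term of a nonempty part of excess 0 need not vanish.\<close>

theorem span_prob_tendsto_1:
  assumes adm: "admissible \<alpha> \<beta> N M" and \<alpha>\<beta>: "0 \<le> \<alpha>" "0 \<le> \<beta>" and A: "finite A" "spans Z A"
    and neg: "\<And>B. \<lbrakk>B \<subseteq> A; B \<noteq> {}\<rbrakk> \<Longrightarrow> excess \<alpha> \<beta> B < 0"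
  shows "((\<lambda>p. span_prob Z (N p) (M p) p) \<longlongrightarrow> 1) (at_right 0)"
proof -
  have "finite (fst ` A \<union> snd ` A)" using A by simp
  then obtain K0 where K0: "\<forall>i\<in>fst ` A \<union> snd ` A. i < K0" by (meson finite_nat_set_iff_bounded)
  \<comment> \<open>The successor guarantees a positive number of blocks.\<close>
  define K where "K = Suc K0"
  have K: "0 < K" by (simp add: K_def)
  have AK: "A \<subseteq> rect K K" using K0 by (auto simp: rect_def K_def ball_Un intro: less_SucI)
  define T where "T = {(L, J). L \<subseteq> {..<K} \<and> J \<subseteq> {..<K} \<and> A \<inter> L \<times> J \<noteq> {}}"
  have finT: "finite T"
    by (rule finite_subset[of _ "Pow {..<K} \<times> Pow {..<K}"]) (auto simp: T_def)
  define y where "y LJ p = real (N p div K) ^ card (fst LJ) * real (M p div K) ^ card (snd LJ) * p ^ card (A \<inter> fst LJ \<times> snd LJ)"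
    for LJ p
  have ev1: "eventually (\<lambda>p::real. 0 < p \<and> p < 1) (at_right 0)" by (rule eventually_at_right_0_less) simp
  have "((\<lambda>p. 1 / y LJ p) \<longlongrightarrow> 0) (at_right 0)" if LJ: "LJ \<in> T" for LJ
  proof -
    define B where "B = A \<inter> fst LJ \<times> snd LJ"
    define s where "s = excess \<alpha> \<beta> B / 2"
    have "B \<noteq> {}" "B \<subseteq> A" using LJ by (auto simp: T_def B_def)
    then have s: "s < 0" "excess \<alpha> \<beta> B < s" using neg[of B] by (auto simp: s_def)
    have "finite (fst LJ)" "finite (snd LJ)"
        using LJ finite_subset[OF _ finite_lessThan] by (auto simp: T_def)
    then have "card (fst ` B) \<le> card (fst LJ)" "card (snd ` B) \<le> card (snd LJ)"
      by (auto intro!: card_mono simp: B_def)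
    then have "real (card B) - \<alpha> * real (card (fst LJ)) - \<beta> * real (card (snd LJ)) \<le> excess \<alpha> \<beta> B"
      using \<alpha>\<beta> unfolding excess_def by (smt (verit) mult_left_mono of_nat_le_iff)
    then have "real (card B) - \<alpha> * real (card (fst LJ)) - \<beta> * real (card (snd LJ)) < s" using s by simp
    from order_tendstoD(2)[OF log_monomial_tendsto[OF admissible_div[OF adm K]] this]
    have "eventually (\<lambda>p. 0 \<le> 1 / y LJ p \<and> 1 / y LJ p \<le> p powr (- s)) (at_right 0)"
      using ev1 admissible_pos[OF admissible_div[OF adm K]]
    proof eventually_elim
      case (elim p)
      have y0: "0 < y LJ p" using elim by (simp add: y_def)
      then have "p powr s < y LJ p"
        using elim ln_ratio_iff_powr(2)[of p "y LJ p" s] by (simp add: y_def B_def)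
      then have "inverse (y LJ p) \<le> inverse (p powr s)"
        using elim by (intro le_imp_inverse_le) auto
      then show ?case using y0 by (simp add: powr_minus inverse_eq_divide)
    qed
    then show ?thesis
      by (intro tendsto_sandwich[OF _ _ tendsto_const powr_small[of "- s"]])
        (use s in \<open>auto elim: eventually_mono\<close>)
  qed
  then have "((\<lambda>p. inverse (1 + (\<Sum>LJ\<in>T. 1 / y LJ p))) \<longlongrightarrow> inverse (1 + (\<Sum>LJ\<in>T. 0))) (at_right 0)"
    by (intro tendsto_intros) auto
  then have lim: "((\<lambda>p. inverse (1 + (\<Sum>LJ\<in>T. 1 / y LJ p))) \<longlongrightarrow> 1) (at_right 0)" by simp
  show ?thesis
  proof (rule tendsto_sandwich[OF _ _ lim tendsto_const])
    show "\<forall>\<^sub>F p in at_right 0. inverse (1 + (\<Sum>LJ\<in>T. 1 / y LJ p)) \<le> span_prob Z (N p) (M p) p"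
      using ev1 span_prob_lower_eventually[OF adm AK A(2)]
    proof eventually_elim
      case (elim p)
      have "0 \<le> (\<Sum>LJ\<in>T. 1 / y LJ p)" using elim by (intro sum_nonneg) (simp add: y_def)
      moreover have "1 \<le> span_prob Z (N p) (M p) p * (1 + (\<Sum>LJ\<in>T. 1 / y LJ p))"
        using elim by (simp add: T_def y_def split_beta)
      ultimately show ?case by (simp add: inverse_eq_divide pos_divide_le_eq)
    qed
    show "\<forall>\<^sub>F p in at_right 0. span_prob Z (N p) (M p) p \<le> 1"
      using ev1 by eventually_elim (simp add: span_prob_le_1)
  qed
qed

end

section \<open>Properties of the rate function\<close>

lemma piecewise_linear_on_affine:
  "polyhedron D \<Longrightarrow> piecewise_linear_on D (\<lambda>x y. c0 + c1 * x + c2 * y)"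
  unfolding piecewise_linear_on_def by (intro exI[of _ "{D}"]) auto

lemma piecewise_linear_on_cong:
  assumes "piecewise_linear_on D f" "\<And>x y. (x, y) \<in> D \<Longrightarrow> f x y = g x y"
  shows "piecewise_linear_on D g"
proof -
  obtain \<P> where \<P>: "finite \<P>" "D = \<Union>\<P>"
    "\<forall>P\<in>\<P>. polyhedron P \<and> (\<exists>c0 c1 c2. \<forall>(x, y)\<in>P. f x y = c0 + c1 * x + c2 * y)"
    using assms(1) unfolding piecewise_linear_on_def by blast
  have "\<exists>c0 c1 c2. \<forall>(x, y)\<in>P. g x y = c0 + c1 * x + c2 * y" if P: "P \<in> \<P>" for P
  proof -
    obtain c0 c1 c2 where c: "\<forall>(x, y)\<in>P. f x y = c0 + c1 * x + c2 * y" using \<P>(3) P by blast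
    have "P \<subseteq> D" using \<P>(2) P by blast
    then have "\<forall>(x, y)\<in>P. g x y = c0 + c1 * x + c2 * y" using c assms(2) by fastforce
    then show ?thesis by blast
  qed
  then show ?thesis unfolding piecewise_linear_on_def using \<P> by (intro exI[of _ \<P>]) blast
qed

text \<open>The flag \<open>b\<close> selects the maximum or the minimum of \<open>f\<close> and \<open>g\<close>.\<close>

lemma piecewise_linear_on_select:
  assumes "piecewise_linear_on D f" "piecewise_linear_on D g"
  shows "piecewise_linear_on D (\<lambda>x y. if (f x y \<le> g x y) = b then g x y else f x y)"
    (is "piecewise_linear_on D ?h")
proof -
  obtain \<P> where \<P>: "finite \<P>" "D = \<Union>\<P>"
    "\<forall>P\<in>\<P>. polyhedron P \<and> (\<exists>c0 c1 c2. \<forall>(x, y)\<in>P. f x y = c0 + c1 * x + c2 * y)"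
    using assms(1) unfolding piecewise_linear_on_def by blast
  obtain \<Q> where \<Q>: "finite \<Q>" "D = \<Union>\<Q>"
    "\<forall>P\<in>\<Q>. polyhedron P \<and> (\<exists>c0 c1 c2. \<forall>(x, y)\<in>P. g x y = c0 + c1 * x + c2 * y)"
    using assms(2) unfolding piecewise_linear_on_def by blast
  define low where "low R = R \<inter> {z. f (fst z) (snd z) \<le> g (fst z) (snd z)}" for R
  define high where "high R = R \<inter> {z. g (fst z) (snd z) \<le> f (fst z) (snd z)}" for R
  \<comment> \<open>On a cell of the common refinement both functions are affine, so comparing them
    cuts the cell by a half-space, and both halves are again polyhedra.\<close>
  define \<R> where "\<R> = (\<lambda>(P, Q). P \<inter> Q) ` (\<P> \<times> \<Q>)"
  have UR: "\<Union>\<R> = D"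
  proof -
    have "\<Union>\<R> = \<Union>\<P> \<inter> \<Union>\<Q>" unfolding \<R>_def by auto
    then show ?thesis using \<P>(2) \<Q>(2) by simp
  qed
  have piece: "polyhedron (low R) \<and> polyhedron (high R)
      \<and> (\<exists>c0 c1 c2. \<forall>(x, y)\<in>low R. ?h x y = c0 + c1 * x + c2 * y)
      \<and> (\<exists>c0 c1 c2. \<forall>(x, y)\<in>high R. ?h x y = c0 + c1 * x + c2 * y)" if R: "R \<in> \<R>" for R
  proof -
    obtain P Q where PQ: "P \<in> \<P>" "Q \<in> \<Q>" "R = P \<inter> Q" using R by (auto simp: \<R>_def)
    obtain c0 c1 c2 where "\<forall>(x, y)\<in>P. f x y = c0 + c1 * x + c2 * y" using \<P>(3) PQ(1) by blast
    then have f: "f (fst z) (snd z) = c0 + c1 * fst z + c2 * snd z" if "z \<in> R" for z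
      using that PQ(3) by (auto simp: split_beta)
    obtain d0 d1 d2 where "\<forall>(x, y)\<in>Q. g x y = d0 + d1 * x + d2 * y" using \<Q>(3) PQ(2) by blast
    then have g: "g (fst z) (snd z) = d0 + d1 * fst z + d2 * snd z" if "z \<in> R" for z
      using that PQ(3) by (auto simp: split_beta)
    have polyR: "polyhedron R" using \<P>(3) \<Q>(3) PQ by auto
    have low_eq: "low R = R \<inter> {z. (c1 - d1, c2 - d2) \<bullet> z \<le> d0 - c0}"
      unfolding low_def using f g by (auto simp: inner_prod_def algebra_simps)
    have high_eq: "high R = R \<inter> {z. (c1 - d1, c2 - d2) \<bullet> z \<ge> d0 - c0}"
      unfolding high_def using f g by (auto simp: inner_prod_def algebra_simps)
    have "polyhedron (low R)"
      unfolding low_eq by (rule polyhedron_Int[OF polyR polyhedron_halfspace_le])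
    moreover have "polyhedron (high R)"
      unfolding high_eq by (rule polyhedron_Int[OF polyR polyhedron_halfspace_ge])
    moreover have "\<exists>c0 c1 c2. \<forall>(x, y)\<in>low R. ?h x y = c0 + c1 * x + c2 * y"
    proof (cases b)
      case True
      then show ?thesis using g by (intro exI[of _ d0] exI[of _ d1] exI[of _ d2]) (force simp: low_def)
    next
      case False
      then show ?thesis using f by (intro exI[of _ c0] exI[of _ c1] exI[of _ c2]) (force simp: low_def)
    qed
    moreover have "\<exists>c0 c1 c2. \<forall>(x, y)\<in>high R. ?h x y = c0 + c1 * x + c2 * y"
    proof (cases b)
      case True
      then show ?thesis using f by (intro exI[of _ c0] exI[of _ c1] exI[of _ c2]) (force simp: high_def)
    next
      case False
      then show ?thesis using g by (intro exI[of _ d0] exI[of _ d1] exI[of _ d2]) (force simp: high_def)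
    qed
    ultimately show ?thesis by blast
  qed
  show ?thesis unfolding piecewise_linear_on_def
  proof (intro exI[of _ "low ` \<R> \<union> high ` \<R>"] conjI)
    show "finite (low ` \<R> \<union> high ` \<R>)" using \<P>(1) \<Q>(1) by (auto simp: \<R>_def)
    have lh: "low R \<union> high R = R" for R by (auto simp: low_def high_def)
    have "\<Union>(low ` \<R> \<union> high ` \<R>) = (\<Union>R\<in>\<R>. low R \<union> high R)"
      by (simp only: Union_Un_distrib UN_Un_distrib)
    then have "\<Union>(low ` \<R> \<union> high ` \<R>) = \<Union>\<R>" by (simp only: lh image_ident)
    then show "D = \<Union>(low ` \<R> \<union> high ` \<R>)" using UR by simp
    show "\<forall>P\<in>low ` \<R> \<union> high ` \<R>. polyhedron P \<and> (\<exists>c0 c1 c2. \<forall>(x, y)\<in>P. ?h x y = c0 + c1 * x + c2 * y)"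
      using piece by (simp add: ball_Un)
  qed
qed

lemma piecewise_linear_on_Max:
  assumes "finite S" "S \<noteq> {}" "\<And>i. i \<in> S \<Longrightarrow> piecewise_linear_on D (F i)"
  shows "piecewise_linear_on D (\<lambda>x y. Max ((\<lambda>i. F i x y) ` S))"
  using assms
proof (induction S rule: finite_ne_induct)
  case (insert a S)
  have "piecewise_linear_on D (\<lambda>x y. if (F a x y \<le> Max ((\<lambda>i. F i x y) ` S)) = True
      then Max ((\<lambda>i. F i x y) ` S) else F a x y)"
    by (rule piecewise_linear_on_select) (use insert in auto)
  then show ?case by (rule piecewise_linear_on_cong) (use insert.hyps in \<open>auto simp: max_def\<close>)
qed simp

lemma piecewise_linear_on_Min:
  assumes "finite S" "S \<noteq> {}" "\<And>i. i \<in> S \<Longrightarrow> piecewise_linear_on D (F i)"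
  shows "piecewise_linear_on D (\<lambda>x y. Min ((\<lambda>i. F i x y) ` S))"
  using assms
proof (induction S rule: finite_ne_induct)
  case (insert a S)
  have "piecewise_linear_on D (\<lambda>x y. if (F a x y \<le> Min ((\<lambda>i. F i x y) ` S)) = False
      then Min ((\<lambda>i. F i x y) ` S) else F a x y)"
    by (rule piecewise_linear_on_select) (use insert in auto)
  then show ?case by (rule piecewise_linear_on_cong) (use insert.hyps in \<open>auto simp: min_def\<close>)
qed simp

lemma continuous_on_Max_family:
  fixes F :: "'i \<Rightarrow> 'a::topological_space \<Rightarrow> real"
  assumes "finite S" "S \<noteq> {}" "\<And>i. i \<in> S \<Longrightarrow> continuous_on D (F i)"
  shows "continuous_on D (\<lambda>x. Max ((\<lambda>i. F i x) ` S))"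
  using assms by (induction S rule: finite_ne_induct) (auto intro: continuous_on_max)

lemma continuous_on_Min_family:
  fixes F :: "'i \<Rightarrow> 'a::topological_space \<Rightarrow> real"
  assumes "finite S" "S \<noteq> {}" "\<And>i. i \<in> S \<Longrightarrow> continuous_on D (F i)"
  shows "continuous_on D (\<lambda>x. Min ((\<lambda>i. F i x) ` S))"
  using assms by (induction S rule: finite_ne_induct) (auto intro: continuous_on_min)

lemma polyhedron_quadrant: "polyhedron {x :: real \<times> real. 0 \<le> fst x \<and> 0 \<le> snd x}"
proof -
  have "{x :: real \<times> real. 0 \<le> fst x \<and> 0 \<le> snd x} = {x. (1, 0) \<bullet> x \<ge> 0} \<inter> {x. (0, 1) \<bullet> x \<ge> 0}"
    by (auto simp: inner_prod_def)
  then show ?thesis by (simp only: polyhedron_Int polyhedron_halfspace_ge)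
qed

section \<open>Dependence of \<open>rho\<close> on the weights\<close>

lemma rho_antimono:
  assumes "finite A" "\<alpha> \<le> \<alpha>'" "\<beta> \<le> \<beta>'"
  shows "rho \<alpha>' \<beta>' A \<le> rho \<alpha> \<beta> A"
proof -
  obtain B where B: "B \<subseteq> A" "rho \<alpha>' \<beta>' A = excess \<alpha>' \<beta>' B" using rho_attained[OF assms(1)] .
  have "excess \<alpha>' \<beta>' B \<le> excess \<alpha> \<beta> B"
    unfolding excess_def using assms by (intro diff_mono mult_right_mono) auto
  then show ?thesis using B excess_le_rho[OF assms(1) B(1), of \<alpha> \<beta>] by simp
qed

text \<open>A new point adds 1 and opens at most one new column and one new row, which together cost
  at most \<alpha> + \<beta> \<le> 1.\<close>

lemma excess_mono_small_weights:
  assumes "finite A" "B \<subseteq> A" "0 \<le> \<alpha>" "0 \<le> \<beta>" "\<alpha> + \<beta> \<le> 1"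
  shows "excess \<alpha> \<beta> B \<le> excess \<alpha> \<beta> A"
proof -
  have insert: "excess \<alpha> \<beta> C \<le> excess \<alpha> \<beta> (insert a C)" if "finite C" "a \<notin> C" for a C
  proof -
    have "card (fst ` insert a C) \<le> card (fst ` C) + 1" "card (snd ` insert a C) \<le> card (snd ` C) + 1"
      using that by (simp_all add: card_insert_if)
    then have "real (card (fst ` insert a C)) \<le> real (card (fst ` C)) + 1"
      "real (card (snd ` insert a C)) \<le> real (card (snd ` C)) + 1" by linarith+
    then have "\<alpha> * real (card (fst ` insert a C)) \<le> \<alpha> * (real (card (fst ` C)) + 1)"
      "\<beta> * real (card (snd ` insert a C)) \<le> \<beta> * (real (card (snd ` C)) + 1)"
      using assms by (auto intro: mult_left_mono)
    then show ?thesis using that assms(5) unfolding excess_def by (simp add: distrib_left)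
  qed
  have "finite C \<Longrightarrow> C \<inter> B = {} \<Longrightarrow> excess \<alpha> \<beta> B \<le> excess \<alpha> \<beta> (C \<union> B)" for C
  proof (induction C rule: finite_induct)
    case (insert a C)
    have "finite (C \<union> B)" using insert assms finite_subset by auto
    then have "excess \<alpha> \<beta> (C \<union> B) \<le> excess \<alpha> \<beta> (insert a (C \<union> B))"
      using insert.hyps insert.prems by (intro \<open>\<And>a C. finite C \<Longrightarrow> a \<notin> C \<Longrightarrow> excess \<alpha> \<beta> C \<le> excess \<alpha> \<beta> (insert a C)\<close>) auto
    then show ?case using insert by auto
  qed simp
  moreover have "(A - B) \<inter> B = {}" "(A - B) \<union> B = A" using assms(2) by auto
  ultimately show ?thesis using assms(1) by (metis finite_Diff)
qed

text \<open>The maximum is attained at \<open>A\<close> itself, so \<open>rho\<close> is affine in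
  the weights on this triangle; the concavity of the rate comes from here.\<close>

lemma rho_small_weights:
  assumes "finite A" "0 \<le> \<alpha>" "0 \<le> \<beta>" "\<alpha> + \<beta> \<le> 1"
  shows "rho \<alpha> \<beta> A = excess \<alpha> \<beta> A"
proof (rule antisym)
  obtain B where "B \<subseteq> A" "rho \<alpha> \<beta> A = excess \<alpha> \<beta> B" using rho_attained[OF assms(1)] .
  then show "rho \<alpha> \<beta> A \<le> excess \<alpha> \<beta> A" using excess_mono_small_weights[OF assms(1) _ assms(2-4)] by simp
qed (rule excess_le_rho[OF assms(1) subset_refl])

lemma excess_swap: "excess \<alpha> \<beta> (prod.swap ` B) = excess \<beta> \<alpha> B"
  by (simp add: excess_def image_image card_image)

lemma excess_disjoint_Un:
  assumes "finite B" "finite C" "fst ` B \<inter> fst ` C = {}" "snd ` B \<inter> snd ` C = {}"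
  shows "excess \<alpha> \<beta> (B \<union> C) = excess \<alpha> \<beta> B + excess \<alpha> \<beta> C"
proof -
  have "B \<inter> C = {}" using assms(3) by blast
  then show ?thesis unfolding excess_def image_Un using assms
    by (simp add: card_Un_disjoint algebra_simps)
qed

section \<open>The support\<close>

text \<open>Rows \<open>0, \<dots>, k - 1\<close> with \<open>u\<close> points each, in pairwise distinct columns beyond the first \<open>k\<close>.\<close>

definition star_rows :: "nat \<Rightarrow> nat \<Rightarrow> pt set" where
  "star_rows k u = (\<lambda>(i, j). (k + i * u + j, i)) ` ({..<k} \<times> {..<u})"

lemma finite_star_rows: "finite (star_rows k u)"
  by (simp add: star_rows_def)

lemma star_rows_range: "x \<in> star_rows k u \<Longrightarrow> k \<le> fst x \<and> snd x < k"
  by (auto simp: star_rows_def)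

text \<open>All points lie in distinct columns, so \<open>B\<close> has as many columns as points,
  and each occupied row holds at most \<open>u\<close> of them. The excess is thus at most the
  number of rows times u (1 - \<alpha>) - \<beta>.\<close>

lemma star_rows_excess_neg:
  assumes B: "B \<subseteq> star_rows k u" "B \<noteq> {}" and \<alpha>: "\<alpha> \<le> 1" and neg: "real u * (1 - \<alpha>) < \<beta>"
  shows "excess \<alpha> \<beta> B < 0"
proof -
  have finB: "finite B" using B finite_star_rows finite_subset by blast
  have "inj_on fst (star_rows k u)"
  proof (rule inj_onI)
    fix x y assume "x \<in> star_rows k u" "y \<in> star_rows k u" "fst x = fst y"
    then obtain i j i' j' where xy: "x = (k + i * u + j, i)" "y = (k + i' * u + j', i')" "j < u" "j' < u"
      "i * u + j = i' * u + j'" by (auto simp: star_rows_def)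
    have "(i * u + j) div u = i" "(i' * u + j') div u = i'" using xy(3,4) by simp_all
    then have "i = i'" using xy(5) by metis
    then show "x = y" using xy by simp
  qed
  then have cf: "card (fst ` B) = card B" using B(1) by (meson card_image inj_on_subset)
  have "B \<subseteq> (\<lambda>(i, j). (k + i * u + j, i)) ` (snd ` B \<times> {..<u})"
  proof
    fix x assume x: "x \<in> B"
    then obtain i j where ij: "x = (k + i * u + j, i)" "j < u" using B(1) by (auto simp: star_rows_def)
    then have "i \<in> snd ` B" using x by force
    then show "x \<in> (\<lambda>(i, j). (k + i * u + j, i)) ` (snd ` B \<times> {..<u})" using ij by auto
  qed
  then have "card B \<le> card ((\<lambda>(i, j). (k + i * u + j, i)) ` (snd ` B \<times> {..<u}))"
    using finB by (intro card_mono) auto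
  also have "\<dots> \<le> card (snd ` B \<times> {..<u})" using finB by (intro card_image_le) auto
  finally have "card B \<le> card (snd ` B) * u" by (simp add: card_cartesian_product)
  then have le: "real (card B) \<le> real (card (snd ` B)) * real u" by (simp flip: of_nat_mult)
  have pos: "0 < real (card (snd ` B))" using B(2) finB by (simp add: card_gt_0_iff)
  have "excess \<alpha> \<beta> B = (1 - \<alpha>) * real (card B) - \<beta> * real (card (snd ` B))"
    unfolding excess_def cf by (simp add: algebra_simps)
  also have "\<dots> \<le> (1 - \<alpha>) * (real (card (snd ` B)) * real u) - \<beta> * real (card (snd ` B))"
    using le \<alpha> by (intro diff_right_mono mult_left_mono) auto
  also have "\<dots> = real (card (snd ` B)) * (real u * (1 - \<alpha>) - \<beta>)" by (simp add: algebra_simps)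
  also have "\<dots> < 0" using pos neg by (simp add: mult_pos_neg)
  finally show ?thesis .
qed

context young_diagram
begin

text \<open>If (u, 0) lies outside \<open>Z\<close>, the first point outside on the horizontal axis
  is taken; otherwise the first point outside \<open>Z\<close> above (u, 0). This reduces arbitrary
  counts outside \<open>Z\<close> to boundary pairs.\<close>

lemma ex_outer_boundary_below:
  assumes "(u, v) \<notin> Z"
  obtains u' v' where "(u', v') \<in> outer_boundary Z" "u' \<le> u" "v' \<le> v"
proof (cases "(u, 0) \<in> Z")
  case False
  define w where "w = (LEAST w. (w, 0) \<notin> Z)"
  have w: "(w, 0) \<notin> Z" "w \<le> u"
    unfolding w_def using False by (rule LeastI, rule Least_le)
  then have "0 < w" using zero_mem by (cases w) auto
  then have "(w - 1, 0) \<in> Z" using not_less_Least[of "w - 1" "\<lambda>w. (w, 0) \<notin> Z"] by (auto simp: w_def)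
  then show ?thesis using w \<open>0 < w\<close> by (intro that[of w 0]) (auto simp: outer_boundary_def)
next
  case True
  define w where "w = (LEAST w. (u, w) \<notin> Z)"
  have w: "(u, w) \<notin> Z" "w \<le> v"
    unfolding w_def using assms by (rule LeastI, rule Least_le)
  then have "0 < w" using True by (cases w) auto
  then have "(u, w - 1) \<in> Z" using not_less_Least[of "w - 1" "\<lambda>w. (u, w) \<notin> Z"] by (auto simp: w_def)
  then show ?thesis using w \<open>0 < w\<close> by (intro that[of u w]) (auto simp: outer_boundary_def)
qed

lemma outer_boundary_le:
  assumes "(u, v) \<in> outer_boundary Z"
  shows "(u, v) \<notin> Z" "u \<le> k" "v \<le> k"
proof -
  show "(u, v) \<notin> Z" using assms by (simp add: outer_boundary_def)
  from assms consider "(u - 1, v) \<in> Z" | "(u, v - 1) \<in> Z" by (auto simp: outer_boundary_def)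
  then have "u \<le> k \<and> v \<le> k" by cases (use bound in fastforce)+
  then show "u \<le> k" "v \<le> k" by auto
qed

text \<open>A point of \<open>rect k k\<close> sees the \<open>u\<close> points of its row in the
  first part and the \<open>v\<close> points of its column in the transposed part, so the square
  fills in one step.\<close>

lemma stars_span:
  assumes "(u, v) \<in> outer_boundary Z"
  shows "spans Z (star_rows k u \<union> prod.swap ` star_rows k v)" (is "spans Z ?A")
proof -
  have "rect k k \<subseteq> NG Z ?A"
  proof
    fix z assume z: "z \<in> rect k k"
    define U where "U = (\<lambda>j. (k + snd z * u + j, snd z)) ` {..<u}"
    define V where "V = (\<lambda>j. (fst z, k + fst z * v + j)) ` {..<v}"
    have "card U = u" "card V = v" unfolding U_def V_def by (simp_all add: card_image inj_on_def)
    moreover have "U \<subseteq> row_pts z ?A"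
      unfolding U_def using z by (force simp: row_pts_def star_rows_def rect_def)
    moreover have "V \<subseteq> col_pts z ?A"
      unfolding V_def using z by (force simp: col_pts_def star_rows_def rect_def)
    moreover have "finite U" "finite V" by (auto simp: U_def V_def)
    ultimately show "z \<in> NG Z ?A" unfolding NG_iff using outer_boundary_le[OF assms]
      by (intro disjI2 exI[of _ U] exI[of _ V]) simp
  qed
  then have "spans Z (NG Z ?A)" by (rule spans_mono[OF rect_spans])
  then have "(NG Z ^^ span_time) (NG Z ?A) = UNIV" by (rule spans_in_bounded_time)
  then have "(NG Z ^^ Suc span_time) ?A = UNIV" by (simp only: funpow_Suc_right comp_apply)
  then show ?thesis by (rule spans_if_NG_iter)
qed

text \<open>The first part lies in columns from \<open>k\<close> on and rows below \<open>k\<close>,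
  the transposed part the other way round. Any subset splits into two pieces with disjoint
  projections, on which the excess is additive.\<close>

lemma stars_excess_neg:
  assumes B: "B \<subseteq> star_rows k u \<union> prod.swap ` star_rows k v" "B \<noteq> {}" and le: "\<alpha> \<le> 1" "\<beta> \<le> 1"
    and neg: "real u * (1 - \<alpha>) < \<beta>" "real v * (1 - \<beta>) < \<alpha>"
  shows "excess \<alpha> \<beta> B < 0"
proof -
  define C where "C = B \<inter> star_rows k u"
  define D where "D = B \<inter> prod.swap ` star_rows k v"
  have BCD: "B = C \<union> D" using B by (auto simp: C_def D_def)
  have C: "excess \<alpha> \<beta> C < 0" if "C \<noteq> {}"
    using that le neg by (intro star_rows_excess_neg[of C k u]) (auto simp: C_def)
  have D: "excess \<alpha> \<beta> D < 0" if "D \<noteq> {}"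
  proof -
    have "prod.swap ` D \<subseteq> star_rows k v" by (auto simp: D_def)
    then have "excess \<beta> \<alpha> (prod.swap ` D) < 0"
      using that le neg by (intro star_rows_excess_neg[of _ k v]) auto
    then show ?thesis by (simp add: excess_swap)
  qed
  have fin: "finite C" "finite D" by (auto simp: C_def D_def finite_star_rows)
  have "fst ` C \<subseteq> {k..}" "snd ` C \<subseteq> {..<k}" "fst ` D \<subseteq> {..<k}" "snd ` D \<subseteq> {k..}"
    using star_rows_range by (force simp: C_def D_def)+
  then have "fst ` C \<inter> fst ` D = {}" "snd ` C \<inter> snd ` D = {}" by fastforce+
  from excess_disjoint_Un[OF fin this]
  have eq: "excess \<alpha> \<beta> B = excess \<alpha> \<beta> C + excess \<alpha> \<beta> D" by (simp add: BCD)
  show ?thesis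
  proof (cases "C = {}")
    case True
    then show ?thesis using eq D B(2) BCD by auto
  next
    case False
    then show ?thesis using eq C D by (cases "D = {}") auto
  qed
qed

lemma rate_fun_zero_outside:
  assumes "(u, v) \<in> outer_boundary Z" "\<alpha> \<le> 1" "\<beta> \<le> 1"
    and "real u * (1 - \<alpha>) < \<beta>" "real v * (1 - \<beta>) < \<alpha>"
  shows "rate_fun \<alpha> \<beta> = 0"
proof -
  let ?A = "star_rows k u \<union> prod.swap ` star_rows k v"
  have fin: "finite ?A" by (simp add: finite_star_rows)
  obtain B where B: "B \<subseteq> ?A" "rho \<alpha> \<beta> ?A = excess \<alpha> \<beta> B" using rho_attained[OF fin] .
  have "rate_fun \<alpha> \<beta> \<le> rho \<alpha> \<beta> ?A" by (rule rate_fun_le_rho[OF fin stars_span[OF assms(1)]])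
  also have "\<dots> \<le> 0" using B stars_excess_neg[OF B(1) _ assms(2-5)] by (cases "B = {}") auto
  finally show ?thesis using rate_fun_nonneg[of \<alpha> \<beta>] by simp
qed

lemma finite_fixed_not_spans:
  assumes "finite A" "NG Z A = A"
  shows "\<not> spans Z A"
proof -
  have "(NG Z ^^ t) A = A" for t by (induction t) (use assms in auto)
  then have "(\<Union>t. (NG Z ^^ t) A) = A" by simp
  moreover have "A \<noteq> UNIV" using assms(1) infinite_UNIV_char_0[where 'a = nat] by (metis finite_prod)
  ultimately show ?thesis by (simp add: spans_def)
qed

lemma rate_fun_pos:
  assumes le: "0 \<le> \<alpha>" "0 \<le> \<beta>" "\<alpha> \<le> 1" "\<beta> \<le> 1"
    and strict: "\<And>u v. (u, v) \<in> outer_boundary Z \<Longrightarrow> \<beta> < real u * (1 - \<alpha>) \<or> \<alpha> < real v * (1 - \<beta>)"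
  shows "0 < rate_fun \<alpha> \<beta>"
proof (rule ccontr)
  assume "\<not> 0 < rate_fun \<alpha> \<beta>"
  then have zero: "rate_fun \<alpha> \<beta> = 0" using rate_fun_nonneg[of \<alpha> \<beta>] by simp
  obtain A where A: "A \<in> basis" "rate_fun \<alpha> \<beta> = rho \<alpha> \<beta> A" by (rule rate_fun_attained)
  have fin: "finite A" and sp: "spans Z A" using basisD[OF A(1)] by auto
  have nonpos: "excess \<alpha> \<beta> B \<le> 0" if "B \<subseteq> A" for B
    using excess_le_rho[OF fin that, of \<alpha> \<beta>] A zero by simp
  have "x \<notin> NG Z A" if "x \<notin> A" for x
  proof -
    define U where "U = row_pts x A"
    define V where "V = col_pts x A"
    have UV: "finite U" "finite V" "U \<subseteq> A" "V \<subseteq> A" using fin by (auto simp: U_def V_def row_pts_def col_pts_def)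
    \<comment> \<open>A nonempty \<open>U\<close> occupies one row and as many columns as it has
      points, so its excess is card U (1 - \<alpha>) - \<beta>; for empty \<open>U\<close> the claim
      is 0 \<le> \<beta>.\<close>
    have "real (card U) * (1 - \<alpha>) \<le> \<beta>"
    proof (cases "U = {}")
      case False
      have "inj_on fst U" by (auto simp: U_def row_pts_def inj_on_def)
      moreover have "snd ` U = {snd x}" using False by (auto simp: U_def row_pts_def)
      ultimately show ?thesis using nonpos[OF UV(3)] by (simp add: excess_def card_image algebra_simps)
    qed (use le in simp)
    moreover have "real (card V) * (1 - \<beta>) \<le> \<alpha>"
    proof (cases "V = {}")
      case False
      have "inj_on snd V" by (auto simp: V_def col_pts_def inj_on_def)
      moreover have "fst ` V = {fst x}" using False by (auto simp: V_def col_pts_def)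
      ultimately show ?thesis using nonpos[OF UV(4)] by (simp add: excess_def card_image algebra_simps)
    qed (use le in simp)
    moreover have "(card U, card V) \<in> Z"
    proof (rule ccontr)
      assume "(card U, card V) \<notin> Z"
      then obtain u v where uv: "(u, v) \<in> outer_boundary Z" "u \<le> card U" "v \<le> card V"
        by (rule ex_outer_boundary_below)
      have "real u * (1 - \<alpha>) \<le> real (card U) * (1 - \<alpha>)" "real v * (1 - \<beta>) \<le> real (card V) * (1 - \<beta>)"
        using uv le by (auto intro!: mult_right_mono)
      then show False using strict[OF uv(1)] calculation by linarith
    qed
    ultimately show ?thesis using that UV by (simp add: NG_def U_def V_def)
  qed
  then have "NG Z A = A" using subset_NG by blast
  then show False using finite_fixed_not_spans[OF fin] sp by simp
qed

section \<open>The support as a closed region of the square\<close>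

definition support_region :: "(real \<times> real) set" where
  "support_region = (\<Inter>(u, v)\<in>outer_boundary Z. {x. x \<in> {0..1} \<times> {0..1} \<and>
     max (real u * (1 - fst x) - snd x) (real v * (1 - snd x) - fst x) \<ge> 0})"

text \<open>Were the boundary empty, the intersection defining \<open>support_region\<close> would
  be the whole plane instead of lying in the square.\<close>

lemma outer_boundary_nonempty: "outer_boundary Z \<noteq> {}"
proof -
  have "(k, k) \<notin> Z" using bound by blast
  then show ?thesis by (rule ex_outer_boundary_below) auto
qed

lemma outside_support_region:
  assumes "x \<in> {0..1} \<times> {0..1}" "x \<notin> support_region"
  obtains u v where "(u, v) \<in> outer_boundary Z" "real u * (1 - fst x) < snd x" "real v * (1 - snd x) < fst x"
proof -
  from assms obtain u v where "(u, v) \<in> outer_boundary Z"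
    "\<not> 0 \<le> max (real u * (1 - fst x) - snd x) (real v * (1 - snd x) - fst x)"
    unfolding support_region_def by blast
  then show ?thesis by (intro that[of u v]) (simp_all add: not_le)
qed

lemma closed_support_region: "closed support_region"
  unfolding support_region_def
proof (intro closed_INT ballI, clarsimp)
  fix u v :: nat
  have "closed (({0..1} \<times> {0..1}) \<inter>
      {x :: real \<times> real. 0 \<le> max (real u * (1 - fst x) - snd x) (real v * (1 - snd x) - fst x)})"
    by (intro closed_Int closed_Times closed_Collect_le continuous_intros)
  then show "closed {x. x \<in> {0..1} \<times> {0..1} \<and>
      0 \<le> max (real u * (1 - fst x) - snd x) (real v * (1 - snd x) - fst x)}"
    by (simp add: Int_def)
qed

text \<open>The expression w (1 - a) - b is affine along the segment from the origin, where it
  equals w. If it is nonnegative at \<open>x\<close> and w > 0, it is strictly positive at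
  \<open>t *\<^sub>R x\<close>, which supplies the strict inequalities that
  \<open>rate_fun_pos\<close> requires.\<close>

lemma rate_fun_pos_scaled:
  assumes x: "x \<in> support_region" and t: "0 \<le> t" "t < 1"
  shows "t *\<^sub>R x \<in> {0..1} \<times> {0..1}" "0 < rate_fun (fst (t *\<^sub>R x)) (snd (t *\<^sub>R x))"
proof -
  have box: "0 \<le> fst x" "fst x \<le> 1" "0 \<le> snd x" "snd x \<le> 1"
    using x outer_boundary_nonempty by (auto simp: support_region_def mem_Times_iff)
  have lt: "t * fst x < 1" "t * snd x < 1" "0 \<le> t * fst x" "0 \<le> t * snd x"
  proof -
    have "t * fst x \<le> t" "t * snd x \<le> t" using box t by (auto intro: mult_left_le)
    then show "t * fst x < 1" "t * snd x < 1" using t by auto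
  qed (use box t in auto)
  show "t *\<^sub>R x \<in> {0..1} \<times> {0..1}" using lt by (simp add: mem_Times_iff)
  have key: "t * b < real w * (1 - t * a)" if "0 \<le> real w * (1 - a) - b" "0 < w" for w :: nat and a b :: real
  proof -
    have "real w * (1 - t * a) - t * b = (1 - t) * real w + t * (real w * (1 - a) - b)"
      by (simp add: algebra_simps)
    moreover have "0 < (1 - t) * real w" "0 \<le> t * (real w * (1 - a) - b)" using t that by auto
    ultimately show ?thesis by linarith
  qed
  show "0 < rate_fun (fst (t *\<^sub>R x)) (snd (t *\<^sub>R x))"
  proof (rule rate_fun_pos)
    fix u v assume uv: "(u, v) \<in> outer_boundary Z"
    then have ne: "u \<noteq> 0 \<or> v \<noteq> 0" using zero_mem outer_boundary_le(1)[OF uv] by (cases u; cases v) auto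
    have "0 \<le> max (real u * (1 - fst x) - snd x) (real v * (1 - snd x) - fst x)"
      using x uv unfolding support_region_def by auto
    then consider "0 \<le> real u * (1 - fst x) - snd x" | "0 \<le> real v * (1 - snd x) - fst x"
      by (auto simp: max_def split: if_splits)
    \<comment> \<open>For u = 0 the first alternative forces snd x = 0; then v is positive and v -
      fst x \<ge> 0 in the square, so the second alternative holds. The case v = 0 is
      symmetric.\<close>
    then have "(0 < u \<and> 0 \<le> real u * (1 - fst x) - snd x) \<or> (0 < v \<and> 0 \<le> real v * (1 - snd x) - fst x)"
    proof cases
      case 1
      then show ?thesis using ne box by (cases "u = 0") auto
    next
      case 2
      then show ?thesis using ne box by (cases "v = 0") auto
    qed
    then show "snd (t *\<^sub>R x) < real u * (1 - fst (t *\<^sub>R x)) \<or> fst (t *\<^sub>R x) < real v * (1 - snd (t *\<^sub>R x))"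
      using key by auto
  qed (use lt in auto)
qed

text \<open>The rate vanishes off the region, which is closed; conversely, each point of the region
  is the limit of its contractions towards the origin, where the rate is positive.\<close>

lemma closure_rate_fun_pos:
  "closure {x. x \<in> {0..1} \<times> {0..1} \<and> 0 < rate_fun (fst x) (snd x)} = support_region" (is "closure ?T = _")
proof
  show "closure ?T \<subseteq> support_region"
  proof (rule closure_minimal[OF _ closed_support_region], rule subsetI)
    fix x assume "x \<in> ?T"
    then have x: "x \<in> {0..1} \<times> {0..1}" "0 < rate_fun (fst x) (snd x)" by auto
    show "x \<in> support_region"
    proof (rule ccontr)
      assume "x \<notin> support_region"
      with x(1) obtain u v where "(u, v) \<in> outer_boundary Z" "real u * (1 - fst x) < snd x" "real v * (1 - snd x) < fst x"
        by (rule outside_support_region)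
      then have "rate_fun (fst x) (snd x) = 0"
        using x(1) by (intro rate_fun_zero_outside) (auto simp: mem_Times_iff)
      then show False using x(2) by simp
    qed
  qed
  show "support_region \<subseteq> closure ?T"
  proof
    fix x assume x: "x \<in> support_region"
    define s where "s n = (1 - inverse (real (Suc n))) *\<^sub>R x" for n
    have "(\<lambda>n. 1 - inverse (real (Suc n))) \<longlonglongrightarrow> 1 - 0"
      by (intro tendsto_intros LIMSEQ_inverse_real_of_nat)
    then have "s \<longlonglongrightarrow> 1 *\<^sub>R x" unfolding s_def by (intro tendsto_intros) simp
    moreover have "s n \<in> ?T" for n
    proof -
      have "0 \<le> 1 - inverse (real (Suc n))" "1 - inverse (real (Suc n)) < 1"
        by (simp_all add: inverse_eq_divide)
      from rate_fun_pos_scaled[OF x this] show ?thesis by (simp only: s_def mem_Collect_eq simp_thms)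
    qed
    ultimately show "x \<in> closure ?T" unfolding closure_sequential by auto
  qed
qed

lemma span_prob_tendsto_1_outside_support:
  assumes "(\<alpha>, \<beta>) \<in> {0..1} \<times> {0..1}" "(\<alpha>, \<beta>) \<notin> support_region" "admissible \<alpha> \<beta> N M"
  shows "((\<lambda>p. span_prob Z (N p) (M p) p) \<longlongrightarrow> 1) (at_right 0)"
proof -
  from assms(1,2) obtain u v where uv: "(u, v) \<in> outer_boundary Z"
    "real u * (1 - fst (\<alpha>, \<beta>)) < snd (\<alpha>, \<beta>)" "real v * (1 - snd (\<alpha>, \<beta>)) < fst (\<alpha>, \<beta>)"
    by (rule outside_support_region)
  show ?thesis
  proof (rule span_prob_tendsto_1[OF assms(3) _ _ _ stars_span[OF uv(1)]])
    show "excess \<alpha> \<beta> B < 0" if "B \<subseteq> star_rows k u \<union> prod.swap ` star_rows k v" "B \<noteq> {}" for B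
      using uv assms(1) by (intro stars_excess_neg[OF that]) auto
  qed (use assms(1) in \<open>auto simp: finite_star_rows\<close>)
qed

section \<open>The main theorem\<close>

lemma rate_fun_antimono:
  assumes "\<alpha> \<le> \<alpha>'" "\<beta> \<le> \<beta>'"
  shows "rate_fun \<alpha>' \<beta>' \<le> rate_fun \<alpha> \<beta>"
proof -
  obtain A where A: "A \<in> basis" "rate_fun \<alpha> \<beta> = rho \<alpha> \<beta> A" by (rule rate_fun_attained)
  then have "rate_fun \<alpha>' \<beta>' \<le> rho \<alpha>' \<beta>' A" using rate_fun_le_rho basisD by simp
  also have "\<dots> \<le> rho \<alpha> \<beta> A" using A basisD assms by (intro rho_antimono) auto
  finally show ?thesis using A by simp
qed

text \<open>In this form continuity and piecewise linearity are formal: each \<open>excess\<close>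
  is affine in the weights, and both properties pass through finite maxima and minima.\<close>

lemma rate_fun_eq_Min_Max:
  "rate_fun \<alpha> \<beta> = Min ((\<lambda>A. Max ((\<lambda>B. excess \<alpha> \<beta> B) ` Pow A)) ` basis)"
  by (simp add: rate_fun_def rho_excess)

lemma continuous_on_rate_fun: "continuous_on D (\<lambda>x. rate_fun (fst x) (snd x))"
  unfolding rate_fun_eq_Min_Max
proof (rule continuous_on_Min_family[OF finite_basis basis_nonempty])
  fix A assume "A \<in> basis"
  then have "finite A" using basisD by simp
  then show "continuous_on D (\<lambda>x. Max ((\<lambda>B. excess (fst x) (snd x) B) ` Pow A))"
    by (intro continuous_on_Max_family) (auto simp: excess_def intro!: continuous_intros)
qed

lemma piecewise_linear_rate_fun:
  assumes "polyhedron D"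
  shows "piecewise_linear_on D rate_fun"
proof -
  have "piecewise_linear_on D (\<lambda>x y. excess x y B)" for B
  proof (rule piecewise_linear_on_cong[OF piecewise_linear_on_affine[OF assms]])
    show "real (card B) + (- real (card (fst ` B))) * x + (- real (card (snd ` B))) * y = excess x y B" for x y
      by (simp add: excess_def)
  qed
  then have "piecewise_linear_on D (\<lambda>x y. Max ((\<lambda>B. excess x y B) ` Pow A))" if "A \<in> basis" for A
    using basisD[OF that] by (intro piecewise_linear_on_Max) auto
  then have "piecewise_linear_on D (\<lambda>x y. Min ((\<lambda>A. Max ((\<lambda>B. excess x y B) ` Pow A)) ` basis))"
    by (intro piecewise_linear_on_Min finite_basis basis_nonempty)
  then show ?thesis by (simp only: flip: rate_fun_eq_Min_Max)
qed

text \<open>The set attaining the minimum at the intermediate point \<open>z\<close> gives a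
  function that is affine on the triangle, lies above the rate there and touches it at
  \<open>z\<close>.\<close>

lemma concave_on_rate_fun:
  "concave_on {x. 0 \<le> fst x \<and> 0 \<le> snd x \<and> fst x + snd x \<le> 1} (\<lambda>x. rate_fun (fst x) (snd x))" (is "concave_on ?D _")
proof -
  have conv: "u *\<^sub>R x + v *\<^sub>R y \<in> ?D" if "x \<in> ?D" "y \<in> ?D" "0 \<le> u" "0 \<le> v" "u + v = 1" for x y u v
  proof -
    have "u * (fst x + snd x) + v * (fst y + snd y) \<le> u * 1 + v * 1"
      using that by (intro add_mono mult_left_mono) auto
    then show ?thesis using that by (simp add: algebra_simps)
  qed
  have "u * rate_fun (fst x) (snd x) + v * rate_fun (fst y) (snd y)
      \<le> rate_fun (fst (u *\<^sub>R x + v *\<^sub>R y)) (snd (u *\<^sub>R x + v *\<^sub>R y))"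
    if *: "x \<in> ?D" "y \<in> ?D" "0 \<le> u" "0 \<le> v" "u + v = 1" for x y u v
  proof -
    define z where "z = u *\<^sub>R x + v *\<^sub>R y"
    have z: "z \<in> ?D" unfolding z_def by (rule conv[OF *])
    obtain A where A: "A \<in> basis" "rate_fun (fst z) (snd z) = rho (fst z) (snd z) A" by (rule rate_fun_attained)
    have fA: "finite A" "spans Z A" using basisD[OF A(1)] by auto
    have le: "rate_fun (fst w) (snd w) \<le> excess (fst w) (snd w) A" if "w \<in> ?D" for w
      using rate_fun_le_rho[OF fA, of "fst w" "snd w"] rho_small_weights[OF fA(1)] that by auto
    have "u * rate_fun (fst x) (snd x) + v * rate_fun (fst y) (snd y)
        \<le> u * excess (fst x) (snd x) A + v * excess (fst y) (snd y) A"
      using * le by (intro add_mono mult_left_mono) auto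
    also have "\<dots> = (u + v) * real (card A) - fst z * real (card (fst ` A)) - snd z * real (card (snd ` A))"
      by (simp add: excess_def z_def algebra_simps)
    also have "\<dots> = excess (fst z) (snd z) A" using * by (simp add: excess_def)
    also have "\<dots> = rate_fun (fst z) (snd z)" using A(2) rho_small_weights[OF fA(1)] z by auto
    finally show ?thesis by (simp add: z_def)
  qed
  moreover have "convex ?D" using conv unfolding convex_def by blast
  ultimately show ?thesis unfolding concave_on_iff by blast
qed

lemma gamma_attained:
  obtains A where "finite A" "spans Z A" "card A = gamma Z"
proof -
  have "\<exists>A. finite A \<and> spans Z A \<and> card A = gamma Z"
    unfolding gamma_def by (rule LeastI_ex) (use rect_spans finite_rect in blast)
  then show ?thesis using that by blast
qed

lemma rho_zero_weights: "finite A \<Longrightarrow> rho 0 0 A = real (card A)"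
  by (simp add: rho_small_weights excess_def)

lemma rate_fun_zero_zero: "rate_fun 0 0 = real (gamma Z)"
proof (rule antisym)
  obtain A where A: "finite A" "spans Z A" "card A = gamma Z" by (rule gamma_attained)
  then show "rate_fun 0 0 \<le> real (gamma Z)" using rate_fun_le_rho[OF A(1,2), of 0 0] by (simp add: rho_zero_weights)
  obtain C where C: "C \<in> basis" "rate_fun 0 0 = rho 0 0 C" by (rule rate_fun_attained)
  have "gamma Z \<le> card C" unfolding gamma_def using basisD[OF C(1)] by (intro Least_le) auto
  then show "real (gamma Z) \<le> rate_fun 0 0" using C basisD by (simp add: rho_zero_weights)
qed

text \<open>In a minimum spanning set, the part attaining \<open>rho\<close> has at most
  \<open>gamma Z\<close> points; if nonempty, its columns and rows cost at least \<alpha> + \<beta>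
  > 0. If it is empty, its value 0 is below \<open>gamma Z\<close> because the empty set does not
  span.\<close>

lemma rate_fun_less_gamma:
  assumes "0 \<le> \<alpha>" "0 \<le> \<beta>" "(\<alpha>, \<beta>) \<noteq> (0, 0)"
  shows "rate_fun \<alpha> \<beta> < real (gamma Z)"
proof -
  obtain A where A: "finite A" "spans Z A" "card A = gamma Z" by (rule gamma_attained)
  obtain B where B: "B \<subseteq> A" "rho \<alpha> \<beta> A = excess \<alpha> \<beta> B" using rho_attained[OF A(1)] .
  have "rate_fun \<alpha> \<beta> \<le> excess \<alpha> \<beta> B" using rate_fun_le_rho[OF A(1,2)] B(2) by metis
  also have "\<dots> < real (gamma Z)"
  proof (cases "B = {}")
    case True
    have "A \<noteq> {}" using A(2) empty_not_spans by auto
    then have "0 < card A" using A(1) by (simp add: card_gt_0_iff)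
    then show ?thesis using True A(3) by simp
  next
    case False
    have finB: "finite B" using A(1) B(1) finite_subset by blast
    have "1 \<le> card (fst ` B)" "1 \<le> card (snd ` B)"
      using False finB by (simp_all add: Suc_le_eq card_gt_0_iff)
    then have "\<alpha> * 1 \<le> \<alpha> * real (card (fst ` B))" "\<beta> * 1 \<le> \<beta> * real (card (snd ` B))"
      using assms(1,2) by (auto intro!: mult_left_mono simp del: mult_1_right)
    moreover have "0 < \<alpha> + \<beta>" using assms by auto
    moreover have "real (card B) \<le> real (gamma Z)" using card_mono[OF A(1) B(1)] A(3) by simp
    ultimately show ?thesis unfolding excess_def by linarith
  qed
  finally show ?thesis .
qed

end

lemma zero_set_young_diagram:
  assumes "zero_set Z" "finite Z" "Z \<noteq> {}"
  obtains k where "young_diagram Z k"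
proof -
  obtain S :: "(nat \<times> nat) set" where S: "Z = (\<Union>(a, b)\<in>S. rect a b)"
    using assms(1) unfolding zero_set_def by blast
  have down: "(u', v') \<in> Z" if uv: "(u, v) \<in> Z" "u' \<le> u" "v' \<le> v" for u v u' v'
  proof -
    obtain a b where "(a, b) \<in> S" "(u, v) \<in> rect a b" using uv(1) S by auto
    moreover from this have "(u', v') \<in> rect a b" using uv by (auto simp: rect_def)
    ultimately show ?thesis using S by auto
  qed
  have "finite (fst ` Z \<union> snd ` Z)" using assms(2) by simp
  then obtain k where k: "\<forall>i\<in>fst ` Z \<union> snd ` Z. i < k" by (meson finite_nat_set_iff_bounded)
  have "u < k \<and> v < k" if "(u, v) \<in> Z" for u v
    using k that by (metis UnI1 UnI2 fst_conv image_eqI snd_conv)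
  moreover have "(0, 0) \<in> Z"
  proof -
    obtain u v where "(u, v) \<in> Z" using assms(3) by auto
    then show ?thesis using down by blast
  qed
  ultimately have "young_diagram Z k" using down by unfold_locales
  then show ?thesis using that by blast
qed

theorem mainTheorem3:
  fixes Z :: "(nat \<times> nat) set"
  assumes "zero_set Z" and "finite Z" and "Z \<noteq> {}"
  shows
    "(\<forall>\<alpha> \<beta>. \<alpha> \<ge> 0 \<longrightarrow> \<beta> \<ge> 0 \<longrightarrow> rate_limit Z \<alpha> \<beta> (rate Z \<alpha> \<beta>))
   \<and> (\<exists>\<A>0. finite \<A>0 \<and> \<A>0 \<noteq> {} \<and> (\<forall>A\<in>\<A>0. finite A \<and> spans Z A) \<and>
        (\<forall>\<alpha> \<beta>. \<alpha> \<ge> 0 \<longrightarrow> \<beta> \<ge> 0 \<longrightarrow>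
           rate Z \<alpha> \<beta> = Inf {rho \<alpha> \<beta> A | A. finite A \<and> spans Z A} \<and>
           rate Z \<alpha> \<beta> = Min ((\<lambda>A. rho \<alpha> \<beta> A) ` \<A>0)))
   \<and> continuous_on {x :: real \<times> real. fst x \<ge> 0 \<and> snd x \<ge> 0} (\<lambda>x. rate Z (fst x) (snd x))
   \<and> piecewise_linear_on {x. fst x \<ge> 0 \<and> snd x \<ge> 0} (rate Z)
   \<and> (\<forall>a a' b. 0 \<le> a \<longrightarrow> a \<le> a' \<longrightarrow> 0 \<le> b \<longrightarrow> rate Z a' b \<le> rate Z a b)
   \<and> (\<forall>a b b'. 0 \<le> a \<longrightarrow> 0 \<le> b \<longrightarrow> b \<le> b' \<longrightarrow> rate Z a b' \<le> rate Z a b)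
   \<and> concave_on {x :: real \<times> real. fst x \<ge> 0 \<and> snd x \<ge> 0 \<and> fst x + snd x \<le> 1}
                 (\<lambda>x. rate Z (fst x) (snd x))
   \<and> rate Z 0 0 = real (gamma Z)
   \<and> (\<forall>\<alpha> \<beta>. \<alpha> \<ge> 0 \<longrightarrow> \<beta> \<ge> 0 \<longrightarrow> (\<alpha>, \<beta>) \<noteq> (0, 0) \<longrightarrow> real (gamma Z) > rate Z \<alpha> \<beta>)
   \<and> closure {x :: real \<times> real. x \<in> {0..1} \<times> {0..1} \<and> rate Z (fst x) (snd x) > 0}
       = (\<Inter>(u, v)\<in>outer_boundary Z.
            {x. x \<in> {0..1} \<times> {0..1} \<and>
                max (real u * (1 - fst x) - snd x) (real v * (1 - snd x) - fst x) \<ge> 0})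
   \<and> (\<forall>\<alpha> \<beta>. (\<alpha>, \<beta>) \<in> {0..1} \<times> {0..1} \<longrightarrow>
        (\<alpha>, \<beta>) \<notin> (\<Inter>(u, v)\<in>outer_boundary Z.
            {x. x \<in> {0..1} \<times> {0..1} \<and>
                max (real u * (1 - fst x) - snd x) (real v * (1 - snd x) - fst x) \<ge> 0}) \<longrightarrow>
        (\<forall>N M. admissible \<alpha> \<beta> N M \<longrightarrow>
           ((\<lambda>p. span_prob Z (N p) (M p) p) \<longlongrightarrow> 1) (at_right 0)))"
proof -
  obtain k where "young_diagram Z k" using zero_set_young_diagram[OF assms] .
  then interpret young_diagram Z k .
  let ?Q = "{x :: real \<times> real. fst x \<ge> 0 \<and> snd x \<ge> 0}"
  let ?T = "{x :: real \<times> real. fst x \<ge> 0 \<and> snd x \<ge> 0 \<and> fst x + snd x \<le> 1}"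
  have Inf_Min: "finite basis \<and> basis \<noteq> {} \<and> (\<forall>A\<in>basis. finite A \<and> spans Z A) \<and>
      (\<forall>\<alpha> \<beta>. \<alpha> \<ge> 0 \<longrightarrow> \<beta> \<ge> 0 \<longrightarrow>
         rate Z \<alpha> \<beta> = Inf {rho \<alpha> \<beta> A | A. finite A \<and> spans Z A} \<and>
         rate Z \<alpha> \<beta> = Min ((\<lambda>A. rho \<alpha> \<beta> A) ` basis))"
  proof (intro conjI ballI allI impI)
    show "rate Z \<alpha> \<beta> = Inf {rho \<alpha> \<beta> A | A. finite A \<and> spans Z A}" if "0 \<le> \<alpha>" "0 \<le> \<beta>" for \<alpha> \<beta>
      using rate_eq[OF that] rate_fun_eq_Inf[of \<alpha> \<beta>] by (rule trans)
    show "rate Z \<alpha> \<beta> = Min ((\<lambda>A. rho \<alpha> \<beta> A) ` basis)" if "0 \<le> \<alpha>" "0 \<le> \<beta>" for \<alpha> \<beta>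
      using rate_eq[OF that] by (simp only: rate_fun_def)
  qed (use finite_basis basis_nonempty basisD in auto)
  \<comment> \<open>\<open>rate\<close> is known to equal \<open>rate_fun\<close> only for
    nonnegative weights, so each regularity property is carried over by agreement on its
    domain.\<close>
  have cont: "continuous_on ?Q (\<lambda>x. rate Z (fst x) (snd x))"
    by (rule continuous_on_eq[OF continuous_on_rate_fun]) (simp add: rate_eq)
  have pl: "piecewise_linear_on ?Q (rate Z)"
    by (rule piecewise_linear_on_cong[OF piecewise_linear_rate_fun[OF polyhedron_quadrant]]) (simp add: rate_eq)
  have conc: "concave_on ?T (\<lambda>x. rate Z (fst x) (snd x))"
  proof -
    have eq: "rate Z (fst x) (snd x) = rate_fun (fst x) (snd x)" if "x \<in> ?T" for x
      using that by (simp add: rate_eq)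
    have conv: "convex ?T" using concave_on_rate_fun unfolding concave_on_iff by blast
    have "u * rate Z (fst x) (snd x) + v * rate Z (fst y) (snd y)
        \<le> rate Z (fst (u *\<^sub>R x + v *\<^sub>R y)) (snd (u *\<^sub>R x + v *\<^sub>R y))"
      if "x \<in> ?T" "y \<in> ?T" "0 \<le> u" "0 \<le> v" "u + v = 1" for x y u v
      unfolding eq[OF that(1)] eq[OF that(2)] eq[OF convexD[OF conv that]]
      using concave_on_rate_fun that unfolding concave_on_iff by blast
    then show ?thesis using conv unfolding concave_on_iff by blast
  qed
  have supp: "closure {x :: real \<times> real. x \<in> {0..1} \<times> {0..1} \<and> rate Z (fst x) (snd x) > 0} = support_region"
  proof -
    have "{x :: real \<times> real. x \<in> {0..1} \<times> {0..1} \<and> rate Z (fst x) (snd x) > 0}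
        = {x. x \<in> {0..1} \<times> {0..1} \<and> 0 < rate_fun (fst x) (snd x)}"
      by (rule Collect_cong) (auto simp: rate_eq)
    then show ?thesis using closure_rate_fun_pos by simp
  qed
  show ?thesis
    unfolding support_region_def[symmetric]
  proof (intro conjI allI impI)
    show "rate_limit Z \<alpha> \<beta> (rate Z \<alpha> \<beta>)" if "0 \<le> \<alpha>" "0 \<le> \<beta>" for \<alpha> \<beta>
      using rate_limit_rate_fun[OF that] by (simp only: rate_eq[OF that])
    show "\<exists>\<A>0. finite \<A>0 \<and> \<A>0 \<noteq> {} \<and> (\<forall>A\<in>\<A>0. finite A \<and> spans Z A) \<and>
        (\<forall>\<alpha> \<beta>. \<alpha> \<ge> 0 \<longrightarrow> \<beta> \<ge> 0 \<longrightarrow>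
           rate Z \<alpha> \<beta> = Inf {rho \<alpha> \<beta> A | A. finite A \<and> spans Z A} \<and>
           rate Z \<alpha> \<beta> = Min ((\<lambda>A. rho \<alpha> \<beta> A) ` \<A>0))"
      using Inf_Min by (rule exI[where x = basis])
    show "rate Z a' b \<le> rate Z a b" if "0 \<le> a" "a \<le> a'" "0 \<le> b" for a a' b
      using that rate_fun_antimono[of a a' b b] by (simp add: rate_eq)
    show "rate Z a b' \<le> rate Z a b" if "0 \<le> a" "0 \<le> b" "b \<le> b'" for a b b'
      using that rate_fun_antimono[of a a b b'] by (simp add: rate_eq)
    show "rate Z 0 0 = real (gamma Z)" using rate_fun_zero_zero by (simp add: rate_eq)
    show "rate Z \<alpha> \<beta> < real (gamma Z)" if "0 \<le> \<alpha>" "0 \<le> \<beta>" "(\<alpha>, \<beta>) \<noteq> (0, 0)" for \<alpha> \<beta>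
      using rate_fun_less_gamma[OF that] that by (simp add: rate_eq)
    show "((\<lambda>p. span_prob Z (N p) (M p) p) \<longlongrightarrow> 1) (at_right 0)"
      if "(\<alpha>, \<beta>) \<in> {0..1} \<times> {0..1}" "(\<alpha>, \<beta>) \<notin> support_region" "admissible \<alpha> \<beta> N M" for \<alpha> \<beta> N M
      using that by (rule span_prob_tendsto_1_outside_support)
  qed (fact cont pl conc supp)+
qed

end
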